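(* Let $f:\Delta\times\mathbb{C}\to\Delta\times\mathbb{C}$ be an attracting polynomial skew product such that $p=f|_L$ satisfies TCE with constant $\mu_{Exp}>1$. If $x\in W^s(J(p))$ slowly approaches $\mathrm{Crit}'$, then $\chi_-(x)\ge\log\mu_{Exp}$.
   Context: Attracting polynomial skew product (normal form): $f(t,z)=(\lambda t,h(t,z))$ with $0<|\lambda|<1$, $h(t,z)=\sum_{i=0}^d a_i(t)z^i$, $d\ge2$, each $a_i$ holomorphic near $0\in\mathbb{C}$, $a_d(0)\ne0$. $\Delta=D(0,r_0)$ is a small disk: the assertion is for every sufficiently small $r_0$ (depending on $f$). The line $L=\{t=0\}$ is identified with $\mathbb{C}$ and $p(z)=h(0,z)$, with Julia set $J(p)$. $\mathrm{Crit}=\{(t,z)\in\Delta\times\mathbb{C}:\partial h/\partial z(t,z)=0\}$; $r_0$ is small enough that each connected component of $\mathrm{Crit}$ meets $L$ at exactly one point. $\mathrm{Crit}'$ is the union of the connected components of $\mathrm{Crit}$ that intersect $J(p)$. $\operatorname{dist}_v(x,y)=|\pi_2(x)-\pi_2(y)|$ with $\pi_2(t,z)=z$; $\operatorname{dist}_v(x,\mathrm{Crit}')$ is the vertical distance from $x$ to the points of $\mathrm{Crit}'$ in the same vertical fiber as $x$. A point $x$ slowly approaches $\mathrm{Crit}'$ if for every $\alpha>0$, $\operatorname{dist}_v(f^n(x),\mathrm{Crit}')\ge e^{-\alpha n}$ for every sufficiently large $n$. $W^s(J(p))=\{x\in\Delta\times\mathbb{C}:\lim_{n\to\infty}\operatorname{dist}(f^n(x),J(p))=0\}$.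 The lower vertical Lyapunov exponent is $\chi_-(x)=\liminf_{n\to\infty}\frac1n\log|Df^n|_x(v)|$, where $v=(0,1)$ is the unit vertical tangent vector. TCE (for $p$ seen as a rational map of $\mathbb{P}^1$ with a fixed Riemannian metric), with constant $\mu_{Exp}>1$: there exists $r>0$ such that for every $y\in J(p)$, every $n\ge0$ and every connected component $W$ of $p^{-n}(D(y,r))$, $\operatorname{diam}(W)\le\mu_{Exp}^{-n}$.
   Formalization: The forward orbit of x is additionally assumed never to meet Crit'; otherwise the vertical derivative vanishes and χ₋(x) = −∞, e.g. f(t,z) = (t/2, z²+i), x = (0,0), which slowly approaches Crit' since only large n count. *)

theory Defs
  imports "HOL-Complex_Analysis.Complex_Analysis"
begin

section \<open>The Riemann sphere with the round metric\<close>

datatype riemann_sphere = Aff complex | AtInf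

text \<open>Inverse stereographic projection onto the unit sphere of \<open>\<complex> \<times> \<real>\<close>.\<close>

primrec stereo :: "riemann_sphere \<Rightarrow> complex \<times> real" where
  "stereo (Aff z) = ((2 / (1 + (cmod z)\<^sup>2)) *\<^sub>R z, ((cmod z)\<^sup>2 - 1) / (1 + (cmod z)\<^sup>2))"
| "stereo AtInf = (0, 1)"

lemma inner_stereo_self: "stereo x \<bullet> stereo x = 1"
proof (cases x)
  case (Aff z)
  have p: "1 + (cmod z)\<^sup>2 > 0" by (smt (verit) zero_le_power2)
  have e: "z \<bullet> z = (cmod z)\<^sup>2" by (simp add: power2_norm_eq_inner)
  have "(2 / (1 + s)) * ((2 / (1 + s)) * s) + ((s - 1) / (1 + s)) * ((s - 1) / (1 + s)) = 1"
    if "1 + s > 0" for s :: real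
    using that by (simp add: divide_simps) (simp add: algebra_simps)
  from this[OF p] show ?thesis
    unfolding Aff by (simp add: e)
qed (simp)

lemma norm_stereo: "norm (stereo x) = 1"
  by (simp add: norm_eq_sqrt_inner inner_stereo_self)

lemma inj_stereo: "stereo x = stereo y \<longleftrightarrow> x = y"
proof
  have ne: "(s - 1) / (1 + s) \<noteq> 1" if "s \<ge> 0" for s :: real
    using that by (simp add: divide_simps)
  have inj: "s = u" if "(s - 1) / (1 + s) = (u - 1) / (1 + u)" "s \<ge> 0" "u \<ge> 0" for s u :: real
    using that by (simp add: divide_simps) (simp add: algebra_simps)
  assume eq: "stereo x = stereo y"
  show "x = y"
  proof (cases x)
    case x: (Aff z)
    show ?thesis
    proof (cases y)
      case y: (Aff w)
      have "snd (stereo x) = snd (stereo y)" "fst (stereo x) = fst (stereo y)"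
        by (simp_all only: eq)
      then have sn: "((cmod z)\<^sup>2 - 1) / (1 + (cmod z)\<^sup>2) = ((cmod w)\<^sup>2 - 1) / (1 + (cmod w)\<^sup>2)"
        and fs: "(2 / (1 + (cmod z)\<^sup>2)) *\<^sub>R z = (2 / (1 + (cmod w)\<^sup>2)) *\<^sub>R w"
        by (simp_all only: x y stereo.simps fst_conv snd_conv)
      have "(cmod z)\<^sup>2 = (cmod w)\<^sup>2"
        by (rule inj[OF sn]) simp_all
      moreover have "2 / (1 + (cmod w)\<^sup>2) \<noteq> 0"
        by (smt (verit) divide_eq_0_iff zero_le_power2)
      ultimately have "z = w"
        using fs by (simp only: real_vector.scale_cancel_left) simp
      then show ?thesis by (simp only: x y)
    next
      case AtInf
      then have "snd (stereo x) = 1" by (simp add: eq)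
      with x ne[of "(cmod z)\<^sup>2"] show ?thesis by simp
    qed
  next
    case AtInf
    show ?thesis
    proof (cases y)
      case (Aff w)
      have "snd (stereo y) = 1" by (simp add: AtInf flip: eq)
      with Aff ne[of "(cmod w)\<^sup>2"] show ?thesis by simp
    qed (simp add: AtInf)
  qed
qed simp

lemma arccos_inner_triangle:
  fixes u v w :: "'a::real_inner"
  assumes "norm u = 1" "norm v = 1" "norm w = 1"
  shows "arccos (u \<bullet> w) \<le> arccos (u \<bullet> v) + arccos (v \<bullet> w)"
proof -
  have bnd: "-1 \<le> x \<bullet> y \<and> x \<bullet> y \<le> 1" if "norm x = 1" "norm y = 1" for x y :: 'a
    using Cauchy_Schwarz_ineq2[of x y] that by auto
  define \<alpha> \<beta> where "\<alpha> = arccos (u \<bullet> v)" and "\<beta> = arccos (v \<bullet> w)"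
  have range: "0 \<le> \<alpha>" "0 \<le> \<beta>" "\<alpha> \<le> pi" "\<beta> \<le> pi"
    using bnd assms by (auto simp: \<alpha>_def \<beta>_def arccos_lbound arccos_ubound)
  have c: "cos \<alpha> = u \<bullet> v" "cos \<beta> = v \<bullet> w"
    using bnd assms by (auto simp: \<alpha>_def \<beta>_def)
  have uu: "u \<bullet> u = 1" "v \<bullet> v = 1" "w \<bullet> w = 1"
    using assms by (simp_all add: norm_eq_1)
  show ?thesis
  proof (cases "\<alpha> + \<beta> \<le> pi")
    case True
    define a b where "a = u - (u \<bullet> v) *\<^sub>R v" and "b = w - (v \<bullet> w) *\<^sub>R v"
    have "a \<bullet> a = 1 - (cos \<alpha>)\<^sup>2" "b \<bullet> b = 1 - (cos \<beta>)\<^sup>2"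
      by (simp_all add: a_def b_def c inner_diff_left inner_diff_right uu
          inner_commute[of v u] inner_commute[of w v] power2_eq_square)
    then have "a \<bullet> a = (sin \<alpha>)\<^sup>2" "b \<bullet> b = (sin \<beta>)\<^sup>2"
      by (simp_all only: sin_squared_eq)
    then have n: "norm a = sin \<alpha>" "norm b = sin \<beta>"
      using range by (simp_all add: norm_eq_sqrt_inner sin_ge_zero)
    have "a \<bullet> b = u \<bullet> w - cos \<alpha> * cos \<beta>"
      by (simp add: a_def b_def c inner_diff_left inner_diff_right uu inner_commute[of v u])
    moreover have "\<bar>a \<bullet> b\<bar> \<le> sin \<alpha> * sin \<beta>"
      using Cauchy_Schwarz_ineq2[of a b] by (simp add: n)
    ultimately have "cos (\<alpha> + \<beta>) \<le> u \<bullet> w" by (simp add: cos_add)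
    then have "arccos (u \<bullet> w) \<le> arccos (cos (\<alpha> + \<beta>))"
      using bnd[OF assms(1,3)] by (intro arccos_le_arccos) auto
    also have "\<dots> = \<alpha> + \<beta>" using True range by (simp add: arccos_cos)
    finally show ?thesis by (simp add: \<alpha>_def \<beta>_def)
  next
    case False
    then show ?thesis
      using arccos_ubound[of "u \<bullet> w"] bnd[OF assms(1,3)] by (auto simp: \<alpha>_def \<beta>_def)
  qed
qed

text \<open>The distance is the geodesic (great-circle) distance of the round Riemannian metric
  \<open>4 |dz|\<^sup>2 / (1 + |z|\<^sup>2)\<^sup>2\<close>, that is, the angle between the image points on the unit sphere.\<close>

instantiation riemann_sphere :: metric_space
begin

definition dist_riemann_sphere :: "riemann_sphere \<Rightarrow> riemann_sphere \<Rightarrow> real" where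
  "dist_riemann_sphere x y = arccos (stereo x \<bullet> stereo y)"

definition uniformity_riemann_sphere :: "(riemann_sphere \<times> riemann_sphere) filter" where
  "uniformity_riemann_sphere = (INF e\<in>{0<..}. principal {(x, y). dist x y < e})"

definition open_riemann_sphere :: "riemann_sphere set \<Rightarrow> bool" where
  "open_riemann_sphere U \<longleftrightarrow>
     (\<forall>x\<in>U. eventually (\<lambda>(x', y). x' = x \<longrightarrow> y \<in> U) uniformity)"

instance
proof
  fix x y z :: riemann_sphere
  show "dist x y = 0 \<longleftrightarrow> x = y"
  proof
    assume "dist x y = 0"
    then have "cos (arccos (stereo x \<bullet> stereo y)) = 1"
      by (simp add: dist_riemann_sphere_def)
    moreover have "\<bar>stereo x \<bullet> stereo y\<bar> \<le> 1"
      using Cauchy_Schwarz_ineq2[of "stereo x" "stereo y"] by (simp add: norm_stereo)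
    ultimately have "stereo x \<bullet> stereo y = 1" by simp
    then have "(stereo x - stereo y) \<bullet> (stereo x - stereo y) = 0"
      by (simp only: inner_diff_left inner_diff_right inner_stereo_self
          inner_commute[of "stereo y" "stereo x"])
    then show "x = y" by (simp only: inner_eq_zero_iff right_minus_eq inj_stereo)
  qed (simp add: dist_riemann_sphere_def inner_stereo_self)
  show "dist x y \<le> dist x z + dist y z"
    using arccos_inner_triangle[OF norm_stereo norm_stereo norm_stereo, of x y z]
    by (simp add: dist_riemann_sphere_def inner_commute)
qed (simp_all add: uniformity_riemann_sphere_def open_riemann_sphere_def)

end


section \<open>Iteration on the Riemann sphere\<close>

text \<open>A nonconstant polynomial extends to the sphere by fixing the point at infinity.\<close>

primrec sphere_ext :: "(complex \<Rightarrow> complex) \<Rightarrow> riemann_sphere \<Rightarrow> riemann_sphere" where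
  "sphere_ext p (Aff z) = Aff (p z)"
| "sphere_ext p AtInf = AtInf"

definition normal_family_on ::
    "riemann_sphere set \<Rightarrow> (riemann_sphere \<Rightarrow> riemann_sphere) set \<Rightarrow> bool" where
  "normal_family_on U \<F> \<longleftrightarrow>
     (\<forall>g::nat \<Rightarrow> riemann_sphere \<Rightarrow> riemann_sphere. range g \<subseteq> \<F> \<longrightarrow>
        (\<exists>\<tau> G. strict_mono \<tau> \<and>
           (\<forall>K. compact K \<and> K \<subseteq> U \<longrightarrow> uniform_limit K (\<lambda>k. g (\<tau> k)) G sequentially)))"

definition fatou_set :: "(riemann_sphere \<Rightarrow> riemann_sphere) \<Rightarrow> riemann_sphere set" where
  "fatou_set P = {x. \<exists>U. open U \<and> x \<in> U \<and> normal_family_on U (range (\<lambda>n. P ^^ n))}"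

definition julia_set :: "(riemann_sphere \<Rightarrow> riemann_sphere) \<Rightarrow> riemann_sphere set" where
  "julia_set P = - fatou_set P"

definition TCE :: "(riemann_sphere \<Rightarrow> riemann_sphere) \<Rightarrow> real \<Rightarrow> bool" where
  "TCE P \<mu> \<longleftrightarrow>
     (\<exists>r>0. \<forall>y\<in>julia_set P. \<forall>n. \<forall>W\<in>components ((P ^^ n) -` ball y r).
        diameter W \<le> 1 / \<mu> ^ n)"


section \<open>Attracting polynomial skew products\<close>

definition skew_product ::
    "complex \<Rightarrow> nat \<Rightarrow> (nat \<Rightarrow> complex \<Rightarrow> complex) \<Rightarrow> complex \<times> complex \<Rightarrow> complex \<times> complex" where
  "skew_product l d a = (\<lambda>(t, z). (l * t, \<Sum>i\<le>d. a i t * z ^ i))"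

text \<open>Below, \<open>f\<close> is a skew product over the disk \<open>\<Delta> = ball 0 r\<close>.
  The line \<open>L = {0} \<times> \<complex>\<close> is invariant, and \<open>fibre_map f 0\<close> is the polynomial \<open>p = f|L\<close>.\<close>

definition fibre_map :: "(complex \<times> complex \<Rightarrow> complex \<times> complex) \<Rightarrow> complex \<Rightarrow> complex \<Rightarrow> complex" where
  "fibre_map f t z = snd (f (t, z))"

definition line_julia :: "(complex \<times> complex \<Rightarrow> complex \<times> complex) \<Rightarrow> (complex \<times> complex) set" where
  "line_julia f = {(0, z) | z. Aff z \<in> julia_set (sphere_ext (fibre_map f 0))}"

definition Crit :: "(complex \<times> complex \<Rightarrow> complex \<times> complex) \<Rightarrow> real \<Rightarrow> (complex \<times> complex) set" where
  "Crit f r = {(t, z). t \<in> ball 0 r \<and> deriv (fibre_map f t) z = 0}"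

definition Crit_julia :: "(complex \<times> complex \<Rightarrow> complex \<times> complex) \<Rightarrow> real \<Rightarrow> (complex \<times> complex) set" where
  "Crit_julia f r = \<Union> {C \<in> components (Crit f r). C \<inter> line_julia f \<noteq> {}}"

text \<open>Extended-real valued, so that the distance to an empty fibre is \<open>\<infinity>\<close>: if the Julia set
  contains no critical point, every point slowly approaches the empty set \<open>Crit_julia f r\<close>.\<close>

definition vdist :: "complex \<times> complex \<Rightarrow> (complex \<times> complex) set \<Rightarrow> ereal" where
  "vdist x S = (INF y\<in>{y \<in> S. fst y = fst x}. ereal (cmod (snd x - snd y)))"

definition slowly_approaches ::
    "(complex \<times> complex \<Rightarrow> complex \<times> complex) \<Rightarrow> complex \<times> complex \<Rightarrow> (complex \<times> complex) set \<Rightarrow> bool" where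
  "slowly_approaches f x S \<longleftrightarrow>
     (\<forall>\<alpha>>0. \<forall>\<^sub>F n in sequentially. ereal (exp (- \<alpha> * real n)) \<le> vdist ((f ^^ n) x) S)"

definition stable_set_julia ::
    "(complex \<times> complex \<Rightarrow> complex \<times> complex) \<Rightarrow> real \<Rightarrow> (complex \<times> complex) set" where
  "stable_set_julia f r =
     {x \<in> ball 0 r \<times> UNIV. (\<lambda>n. infdist ((f ^^ n) x) (line_julia f)) \<longlonglongrightarrow> 0}"

text \<open>The logarithm with the value \<open>-\<infinity>\<close> at 0 (the library has \<open>ln 0 = 0\<close>).\<close>

definition eln :: "real \<Rightarrow> ereal" where
  "eln y = (if y \<le> 0 then -\<infinity> else ereal (ln y))"

definition lower_lyapunov ::
    "(complex \<times> complex \<Rightarrow> complex \<times> complex) \<Rightarrow> complex \<times> complex \<Rightarrow> ereal" where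
  "lower_lyapunov f x =
     liminf (\<lambda>n. ereal (1 / real n) * eln (norm (frechet_derivative (f ^^ n) (at x) (0, 1))))"

end

theory Submission
  imports Defs "HOL-Computational_Algebra.Fundamental_Theorem_Algebra"
begin

text \<open>Write \<open>z n\<close> for the vertical coordinate of \<open>f^n x\<close> and \<open>H n\<close> for the fibre polynomial over
\<open>\<lambda>^n t\<close>. The vertical derivative of \<open>f^n\<close> at \<open>x\<close> is the product of the numbers \<open>H j ' (z j)\<close> with
\<open>j < n\<close>, and \<open>z\<close> is a pseudo-orbit of \<open>p\<close> with errors of order \<open>|\<lambda>|^n\<close> that converges to
the Julia set \<open>J\<close>.

Expansion is read off from contraction backwards. By TCE a connected set that \<open>p^m\<close> maps into a
small disk about a point of \<open>J\<close> has diameter at most \<open>C / \<mu>^m\<close>. Let \<open>M\<close> be a Lipschitz constant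
of \<open>p\<close>, let \<open>i\<close> be large, and let \<open>k \<le> \<tau> i\<close>, where \<open>\<tau>\<close> is a small multiple of
\<open>log (1/|\<lambda>|) / log M\<close>. During the block of times from \<open>i\<close> to \<open>i + k\<close> the maps \<open>H j\<close> and \<open>p\<close>
drift apart by at most about \<open>M^k |\<lambda>|^i\<close>, which is exponentially small in \<open>i\<close>. Take the disk of
radius \<open>exp (-\<delta> i)\<close> about \<open>z (i + k)\<close>. It stays inside a TCE disk for another
\<open>q = \<delta> i / (2 log M)\<close> iterates of \<open>p\<close>, and so its pull-back by the last \<open>m\<close> maps of the block has
diameter at most \<open>C / \<mu>^(m + q)\<close>. This is below a fixed exponential in \<open>i\<close>. Slow approach bounds
\<open>|H j ' (z j)|\<close> below by any exponential that decays, so the inverse branch of \<open>H j\<close> at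
\<open>z (j + 1)\<close> is defined on a disk that contains the pull-back. The branches compose to an inverse
branch along the block, and the Cauchy inequality for it says that the block expands by at least
\<open>exp (-\<delta> i) \<mu>^k\<close> (\<open>block_expansion\<close>). The length of a block may grow in proportion to its
starting time. The starting times therefore form a geometric progression, the losses \<open>\<delta> i\<close> of all
blocks before time \<open>n\<close> add up to a multiple of \<open>\<delta> n\<close>, and \<open>\<delta>\<close> is arbitrary
(\<open>sublinear_loss_by_geometric_blocks\<close>, \<open>derivative_growth\<close>).

Slow approach speaks only of the components of \<open>Crit\<close> through critical points in \<open>J\<close>. Those
through a critical point of \<open>p\<close> off \<open>J\<close> are excluded by TCE again. A point that \<open>p^k\<close> takes near \<open>J\<close>
lies within \<open>C / \<mu>^k\<close> of \<open>J\<close>. Hence a point off \<open>J\<close> leaves a fixed neighbourhood of \<open>J\<close> after a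
number of iterates that depends only on its distance from \<open>J\<close>, and it is outside again at regular
times; this persists for pseudo-orbits with small errors (\<open>pseudo_orbit_off_J\<close>). For a small disk
\<open>\<Delta>\<close> no point near such a critical point is therefore in \<open>W^s(J)\<close>, and the orbit of \<open>x\<close> never meets
these components. As it misses \<open>Crit'\<close> by assumption, no factor \<open>H j ' (z j)\<close> vanishes.\<close>

section \<open>The round metric in the affine chart\<close>

text \<open>The geodesic distance is compared with the Euclidean distance of the affine chart through the length
of the chord in the ambient space of the sphere, for which there are closed formulas.\<close>

lemma abs_inner_stereo_le: "\<bar>stereo x \<bullet> stereo y\<bar> \<le> 1"
  using Cauchy_Schwarz_ineq2[of "stereo x" "stereo y"] by (simp add: norm_stereo)

lemma sphere_dist_bounds: "0 \<le> dist x y" "dist x y \<le> pi" for x y :: riemann_sphere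
  using abs_inner_stereo_le[of x y]
  by (auto simp: dist_riemann_sphere_def abs_le_iff intro!: arccos_lbound arccos_ubound)

lemma chord_sq: "(norm (stereo x - stereo y))\<^sup>2 = 2 - 2 * (stereo x \<bullet> stereo y)"
  by (simp add: power2_norm_eq_inner inner_diff_left inner_diff_right inner_stereo_self
        inner_commute[of "stereo y" "stereo x"])

lemma chord_eq_sin: "norm (stereo x - stereo y) = 2 * sin (dist x y / 2)"
proof -
  have c: "cos (dist x y) = stereo x \<bullet> stereo y"
    unfolding dist_riemann_sphere_def using abs_inner_stereo_le[of x y] by (simp add: cos_arccos_abs)
  have "(norm (stereo x - stereo y))\<^sup>2 = 2 - 2 * cos (2 * (dist x y / 2))"
    by (simp add: chord_sq c)
  also have "\<dots> = (2 * sin (dist x y / 2))\<^sup>2"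
    by (simp only: cos_double_sin) (simp add: power2_eq_square algebra_simps)
  finally show ?thesis
    using sphere_dist_bounds[of x y] pi_ge_zero
    by (rule_tac power2_eq_imp_eq) (auto intro!: sin_ge_zero simp del: pi_ge_zero)
qed

lemma chord_le_dist: "norm (stereo x - stereo y) \<le> dist x y"
  using sin_x_le_x[of "dist x y / 2"] by (simp add: chord_eq_sin)

lemma dist_eq_arcsin: "dist x y = 2 * arcsin (norm (stereo x - stereo y) / 2)"
proof -
  have "arcsin (sin (dist x y / 2)) = dist x y / 2"
    using sphere_dist_bounds[of x y] by (intro arcsin_sin) linarith+
  then show ?thesis by (simp add: chord_eq_sin)
qed

lemma dist_less_if_chord_less:
  assumes "r > 0"
  shows "\<exists>e>0. \<forall>x y. norm (stereo x - stereo y) < e \<longrightarrow> dist x y < r"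
proof -
  have "isCont arcsin 0" by (rule isCont_arcsin) auto
  then obtain e where e: "e > 0" "\<And>s. \<bar>s\<bar> < e \<Longrightarrow> \<bar>arcsin s\<bar> < r / 2"
    using assms unfolding continuous_at_eps_delta
    by (force simp: dist_real_def dest: spec[of _ "r/2"])
  have "dist x y < r" if "norm (stereo x - stereo y) < 2 * e" for x y
    using e(2)[of "norm (stereo x - stereo y) / 2"] that unfolding dist_eq_arcsin by auto
  then show ?thesis using e(1) by (intro exI[of _ "2 * e"]) auto
qed

lemma chord_Aff_sq:
  "(norm (stereo (Aff u) - stereo (Aff v)))\<^sup>2 =
     4 * (cmod (u - v))\<^sup>2 / ((1 + (cmod u)\<^sup>2) * (1 + (cmod v)\<^sup>2))"
proof -
  have *: "2 - 2 * (4 * i / ((1 + a) * (1 + b)) + (a - 1) * (b - 1) / ((1 + a) * (1 + b)))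
      = 4 * (a + b - 2 * i) / ((1 + a) * (1 + b))" if "a \<ge> 0" "b \<ge> 0" for a b i :: real
    using that by (simp add: divide_simps) (simp add: algebra_simps)
  have n: "(cmod (u - v))\<^sup>2 = (cmod u)\<^sup>2 + (cmod v)\<^sup>2 - 2 * (u \<bullet> v)"
    by (simp add: power2_norm_eq_inner inner_diff_left inner_diff_right inner_commute)
  show ?thesis
    unfolding chord_sq n using *[of "(cmod u)\<^sup>2" "(cmod v)\<^sup>2" "u \<bullet> v"]
    by (simp add: algebra_simps)
qed

lemma chord_AtInf_sq: "(norm (stereo (Aff u) - stereo AtInf))\<^sup>2 = 4 / (1 + (cmod u)\<^sup>2)"
proof -
  have "2 - 2 * ((a - 1) / (1 + a)) = 4 / (1 + a)" if "a \<ge> 0" for a :: real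
    using that by (simp add: divide_simps)
  then show ?thesis unfolding chord_sq by simp
qed

lemma chord_Aff_le: "norm (stereo (Aff u) - stereo (Aff v)) \<le> 2 * cmod (u - v)"
proof (rule power2_le_imp_le)
  have "1 * 1 \<le> (1 + (cmod u)\<^sup>2) * (1 + (cmod v)\<^sup>2)"
    by (intro mult_mono) auto
  then have "4 * (cmod (u - v))\<^sup>2 / ((1 + (cmod u)\<^sup>2) * (1 + (cmod v)\<^sup>2)) \<le> 4 * (cmod (u - v))\<^sup>2 / 1"
    by (intro divide_left_mono) auto
  then show "(norm (stereo (Aff u) - stereo (Aff v)))\<^sup>2 \<le> (2 * cmod (u - v))\<^sup>2"
    unfolding chord_Aff_sq by (simp add: power_mult_distrib)
qed simp

lemma norm_diff_le_dist_Aff: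
  assumes "cmod u \<le> R" "cmod v \<le> R"
  shows "cmod (u - v) \<le> (1 + R\<^sup>2) * dist (Aff u) (Aff v)"
proof -
  have R: "(cmod u)\<^sup>2 \<le> R\<^sup>2" "(cmod v)\<^sup>2 \<le> R\<^sup>2"
    using assms by (auto intro!: power_mono)
  have pos: "(1 + (cmod u)\<^sup>2) * (1 + (cmod v)\<^sup>2) > 0"
    by (intro mult_pos_pos add_pos_nonneg) auto
  have "(1 + (cmod u)\<^sup>2) * (1 + (cmod v)\<^sup>2) \<le> (1 + R\<^sup>2) * (1 + R\<^sup>2)"
    using R by (intro mult_mono) auto
  then have "4 * (cmod (u - v))\<^sup>2 / ((1 + R\<^sup>2) * (1 + R\<^sup>2)) \<le>
      4 * (cmod (u - v))\<^sup>2 / ((1 + (cmod u)\<^sup>2) * (1 + (cmod v)\<^sup>2))"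
    using pos by (intro divide_left_mono mult_pos_pos) (auto intro: add_pos_nonneg)
  then have "(2 * cmod (u - v) / (1 + R\<^sup>2))\<^sup>2 \<le> (norm (stereo (Aff u) - stereo (Aff v)))\<^sup>2"
    unfolding chord_Aff_sq by (simp add: power_divide power_mult_distrib power2_eq_square)
  then have "2 * cmod (u - v) / (1 + R\<^sup>2) \<le> norm (stereo (Aff u) - stereo (Aff v))"
    by (rule power2_le_imp_le) simp
  also have "\<dots> \<le> dist (Aff u) (Aff v)" by (rule chord_le_dist)
  finally have "2 * cmod (u - v) \<le> (1 + R\<^sup>2) * dist (Aff u) (Aff v)"
    using add_pos_nonneg[of 1 "R\<^sup>2"] by (simp add: divide_simps mult.commute split: if_splits)
  moreover have "0 \<le> cmod (u - v)" by simp
  ultimately show ?thesis by linarith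
qed

lemma uniformly_continuous_Aff:
  assumes "r > 0"
  shows "\<exists>e>0. \<forall>u v. cmod (u - v) < e \<longrightarrow> dist (Aff u) (Aff v) < r"
proof -
  obtain e where e: "e > 0" "\<And>x y. norm (stereo x - stereo y) < e \<Longrightarrow> dist x y < r"
    using dist_less_if_chord_less[OF assms] by blast
  have "dist (Aff u) (Aff v) < r" if "cmod (u - v) < e / 2" for u v
    by (rule e(2)) (use chord_Aff_le[of u v] that in linarith)
  then show ?thesis using e(1) by (intro exI[of _ "e/2"]) auto
qed

lemma continuous_on_Aff: "continuous_on S Aff"
  unfolding continuous_on_iff
  by (metis dist_norm uniformly_continuous_Aff)

lemma dist_AtInf_small:
  assumes "r > 0"
  shows "\<exists>B>0. \<forall>u. cmod u > B \<longrightarrow> dist (Aff u) AtInf < r"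
proof -
  obtain e where e: "e > 0" "\<And>x y. norm (stereo x - stereo y) < e \<Longrightarrow> dist x y < r"
    using dist_less_if_chord_less[OF assms] by blast
  have "dist (Aff u) AtInf < r" if u: "cmod u > 2 / e" for u
  proof (rule e(2), rule power2_less_imp_less)
    have "2 < e * cmod u" using u e(1) by (simp add: field_simps)
    then have "2\<^sup>2 < (e * cmod u)\<^sup>2" by (intro power_strict_mono) auto
    then have "4 < e\<^sup>2 * (1 + (cmod u)\<^sup>2)" by (simp add: power_mult_distrib algebra_simps add_pos_nonneg)
       (smt (verit) zero_le_power2)
    then show "(norm (stereo (Aff u) - stereo AtInf))\<^sup>2 < e\<^sup>2"
      unfolding chord_AtInf_sq by (subst pos_divide_less_eq) (auto intro: add_pos_nonneg)
  qed (use e in simp)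
  then show ?thesis using e(1) by (intro exI[of _ "2/e"]) auto
qed

text \<open>Stereographic projection is continuous away from the pole, and the image of \<open>V\<close> is the preimage
of \<open>V\<close> under it.\<close>

lemma open_Aff_image:
  assumes "open V"
  shows "open (Aff ` V)"
proof -
  define pr where "pr = (\<lambda>y. (1 / (1 - snd (stereo y))) *\<^sub>R fst (stereo y))"
  have snd_ne: "snd (stereo y) \<noteq> 1" if "y \<noteq> AtInf" for y
  proof (cases y)
    case (Aff z)
    have "(a - 1) / (1 + a) \<noteq> 1" if "a \<ge> 0" for a :: real using that by (simp add: divide_simps)
    then show ?thesis using Aff by simp
  qed (use that in simp)
  have "continuous_on UNIV stereo"
    unfolding continuous_on_iff using chord_le_dist by (metis dist_norm le_less_trans dist_commute)
  then have "continuous_on (- {AtInf}) stereo" by (rule continuous_on_subset) auto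
  then have "continuous_on (- {AtInf}) pr"
    unfolding pr_def using snd_ne
    by (auto intro!: continuous_intros)
  then have "open (- {AtInf} \<inter> pr -` V)"
    by (rule continuous_open_preimage) (use assms in auto)
  moreover have "pr (Aff z) = z" for z
  proof -
    define s where "s = (cmod z)\<^sup>2"
    have "pr (Aff z) = (1 / (1 - (s - 1) / (1 + s)) * (2 / (1 + s))) *\<^sub>R z"
      unfolding pr_def s_def by (simp only: stereo.simps fst_conv snd_conv scaleR_scaleR)
    also have "1 / (1 - (s - 1) / (1 + s)) * (2 / (1 + s)) = 1"
    proof -
      have "s \<ge> 0" by (simp add: s_def)
      then have "1 - (s - 1) / (1 + s) = 2 / (1 + s)" "1 + s \<noteq> 0" by (auto simp: divide_simps)
      then show ?thesis by simp
    qed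
    finally show ?thesis by simp
  qed
  then have "- {AtInf} \<inter> pr -` V = Aff ` V"
    by (auto simp: image_iff) (metis riemann_sphere.exhaust)+
  ultimately show ?thesis by simp
qed

section \<open>Julia sets of entire maps that expand near infinity\<close>

text \<open>A sequence of iterates is a sequence of exponents, so in proofs of normality one may assume that
the exponents are constant or tend to infinity.\<close>

lemma nat_seq_constant_or_unbounded_subseq:
  fixes m :: "nat \<Rightarrow> nat"
  shows "\<exists>\<tau>::nat \<Rightarrow> nat. strict_mono \<tau> \<and>
    ((\<exists>c. \<forall>k. m (\<tau> k) = c) \<or> filterlim (\<lambda>k. m (\<tau> k)) at_top sequentially)"
proof (cases "\<exists>c. infinite {k. m k = c}")
  case True
  then obtain c where c: "infinite {k. m k = c}" by blast
  have "m (enumerate {k. m k = c} k) = c" for k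
    using enumerate_in_set[OF c, of k] by simp
  then show ?thesis using strict_mono_enumerate[OF c] by blast
next
  case False
  have "filterlim m at_top sequentially"
    unfolding filterlim_at_top
  proof
    fix Z
    have "{k. \<not> Z \<le> m k} = (\<Union>c<Z. {k. m k = c})" by auto
    then have "finite {k. \<not> Z \<le> m k}" using False by simp
    then show "\<forall>\<^sub>F k in sequentially. Z \<le> m k"
      by (simp add: eventually_cofinite flip: cofinite_eq_sequentially)
  qed
  then show ?thesis by (intro exI[of _ id]) (auto simp: strict_mono_id)
qed

lemma normal_family_onD:
  fixes g :: "nat \<Rightarrow> riemann_sphere \<Rightarrow> riemann_sphere"
  assumes "normal_family_on U \<F>" and g: "range g \<subseteq> \<F>" and K: "compact K" "K \<subseteq> U"
  obtains \<tau> :: "nat \<Rightarrow> nat" and G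
  where "strict_mono \<tau>" "uniform_limit K (\<lambda>k. g (\<tau> k)) G sequentially"
proof -
  have "\<exists>\<tau> G. strict_mono \<tau> \<and>
      (\<forall>K. compact K \<and> K \<subseteq> U \<longrightarrow> uniform_limit K (\<lambda>k. g (\<tau> k)) G sequentially)"
    using assms(1) g unfolding normal_family_on_def by (drule_tac spec[of _ g]) (rule mp)
  then show thesis using K that by blast
qed

text \<open>Every polynomial of degree at least two satisfies these assumptions with a large \<open>R\<close>. What follows
about Julia sets and TCE depends only on them.\<close>

locale escaping_entire =
  fixes p :: "complex \<Rightarrow> complex" and R :: real
  assumes holo: "p holomorphic_on UNIV" and R_ge: "1 \<le> R"
    and escape: "\<And>z. R < cmod z \<Longrightarrow> 2 * cmod z \<le> cmod (p z)"
begin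

abbreviation P :: "riemann_sphere \<Rightarrow> riemann_sphere" where "P \<equiv> sphere_ext p"

definition J :: "complex set" where "J = {z. Aff z \<in> julia_set P}"

lemma funpow_Aff: "(P ^^ n) (Aff z) = Aff ((p ^^ n) z)"
  by (induction n) auto

lemma holo_funpow: "(p ^^ n) holomorphic_on UNIV"
proof (induction n)
  case (Suc n)
  have "(p \<circ> (p ^^ n)) holomorphic_on UNIV"
    by (rule holomorphic_on_compose_gen[OF Suc holo]) auto
  then show ?case by (simp only: funpow.simps)
qed (simp add: id_def)

lemma continuous_funpow: "continuous_on S (p ^^ n)"
  using holo_funpow holomorphic_on_imp_continuous_on continuous_on_subset by blast

lemma escape_funpow: "R < cmod z \<Longrightarrow> 2 ^ n * cmod z \<le> cmod ((p ^^ n) z)"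
proof (induction n)
  case (Suc n)
  then have *: "2 ^ n * cmod z \<le> cmod ((p ^^ n) z)" by simp
  have "1 * cmod z \<le> 2 ^ n * cmod z" by (intro mult_right_mono) auto
  then have "R < cmod ((p ^^ n) z)" using * Suc.prems by linarith
  from escape[OF this] * show ?case by simp
qed simp

lemma norm_le_if_funpow_norm_le:
  assumes "cmod ((p ^^ n) z) \<le> B" "R \<le> B"
  shows "cmod z \<le> B"
proof (rule ccontr)
  assume "\<not> cmod z \<le> B"
  then have "2 ^ n * cmod z \<le> B" using escape_funpow[of z n] assms by simp
  moreover have "1 * cmod z \<le> 2 ^ n * cmod z" by (intro mult_right_mono) auto
  ultimately show False using \<open>\<not> cmod z \<le> B\<close> by simp
qed

text \<open>A point outside the escape radius is no larger than its image, so a constant value would bound the whole plane.\<close>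

lemma not_constant_funpow: "\<not> (p ^^ n) constant_on UNIV"
proof
  assume "(p ^^ n) constant_on UNIV"
  then obtain c where c: "(p ^^ n) z = c" for z by (auto simp: constant_on_def)
  define z where "z = complex_of_real (R + 1 + cmod c)"
  have n: "cmod z = R + 1 + cmod c" unfolding z_def using R_ge by (simp only: norm_of_real) simp
  have "cmod z \<le> max R (cmod c)"
    using norm_le_if_funpow_norm_le[of n z "max R (cmod c)"] c by simp
  then show False unfolding n using R_ge by (smt (verit) norm_ge_zero)
qed

lemma open_funpow_image: "open U \<Longrightarrow> open ((p ^^ n) ` U)"
  using open_mapping_thm[OF holo_funpow open_UNIV connected_UNIV _ _ not_constant_funpow] by simp

text \<open>Beyond the escape radius the iterates converge to infinity uniformly, so these points belong to the
Fatou set.\<close>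

lemma J_bounded:
  assumes "z \<in> J"
  shows "cmod z \<le> R"
proof (rule ccontr)
  assume z: "\<not> cmod z \<le> R"
  define U where "U = Aff ` (- cball 0 R)"
  have "normal_family_on U (range (\<lambda>n. P ^^ n))"
    unfolding normal_family_on_def
  proof (intro allI impI)
    fix g :: "nat \<Rightarrow> riemann_sphere \<Rightarrow> riemann_sphere" assume "range g \<subseteq> range (\<lambda>n. P ^^ n)"
    then have "\<forall>k. \<exists>n. g k = P ^^ n" by blast
    then obtain m where m: "g k = P ^^ m k" for k by metis
    obtain \<tau> :: "nat \<Rightarrow> nat" where \<tau>: "strict_mono \<tau>"
      "(\<exists>c. \<forall>k. m (\<tau> k) = c) \<or> filterlim (\<lambda>k. m (\<tau> k)) at_top sequentially"
      using nat_seq_constant_or_unbounded_subseq by blast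
    have "\<exists>G. uniform_limit U (\<lambda>k. g (\<tau> k)) G sequentially"
      using \<tau>(2)
    proof
      assume "\<exists>c. \<forall>k. m (\<tau> k) = c"
      then obtain c where "\<And>k. g (\<tau> k) = P ^^ c" using m by auto
      then show ?thesis by (auto intro: uniform_limit_const)
    next
      assume lim: "filterlim (\<lambda>k. m (\<tau> k)) at_top sequentially"
      have "uniform_limit U (\<lambda>k. g (\<tau> k)) (\<lambda>_. AtInf) sequentially"
      proof (rule uniform_limitI)
        fix e :: real assume "e > 0"
        then obtain B where B: "B > 0" "\<And>u. cmod u > B \<Longrightarrow> dist (Aff u) AtInf < e"
          using dist_AtInf_small by blast
        obtain N :: nat where N: "B < 2 ^ N" using real_arch_pow[of 2 B] by auto
        have "dist (g (\<tau> k) x) AtInf < e" if "N \<le> m (\<tau> k)" "x \<in> U" for k x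
        proof -
          from that obtain z where z: "x = Aff z" "R < cmod z" by (auto simp: U_def)
          have "(2::real) ^ N * 1 \<le> 2 ^ m (\<tau> k) * cmod z"
            using z R_ge that by (intro mult_mono power_increasing) auto
          then have "B < cmod ((p ^^ m (\<tau> k)) z)"
            using escape_funpow[OF z(2), of "m (\<tau> k)"] N by linarith
          then show ?thesis using B(2) by (simp add: m z funpow_Aff)
        qed
        moreover have "\<forall>\<^sub>F k in sequentially. N \<le> m (\<tau> k)"
          using lim by (simp add: filterlim_at_top)
        ultimately show "\<forall>\<^sub>F k in sequentially. \<forall>x\<in>U. dist (g (\<tau> k) x) AtInf < e"
          by (auto elim: eventually_mono)
      qed
      then show ?thesis by blast
    qed
    then show "\<exists>\<tau> G. strict_mono \<tau> \<and>
           (\<forall>K. compact K \<and> K \<subseteq> U \<longrightarrow> uniform_limit K (\<lambda>k. g (\<tau> k)) G sequentially)"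
      using \<tau>(1) uniform_limit_on_subset by blast
  qed
  moreover have "open U" unfolding U_def by (intro open_Aff_image) auto
  moreover have "Aff z \<in> U" using z by (auto simp: U_def)
  ultimately show False using assms by (auto simp: J_def julia_set_def fatou_set_def)
qed

lemma closed_J: "closed J"
proof -
  have "open (fatou_set P)"
    unfolding open_subopen[of "fatou_set P"] by (auto simp: fatou_set_def)
  then have "open (Aff -` fatou_set P)"
    using continuous_on_Aff[of UNIV] by (simp add: continuous_on_open_vimage)
  moreover have "J = - (Aff -` fatou_set P)" by (auto simp: J_def julia_set_def)
  ultimately show ?thesis by (simp only: closed_Compl)
qed

text \<open>Otherwise \<open>1 / (p z - z)\<close> would be entire and tend to 0 at infinity.\<close>

lemma exists_fixed_point: "\<exists>z. p z = z"
proof -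
  have "(\<lambda>z. p z - z) holomorphic_on UNIV" by (intro holomorphic_intros holo)
  moreover have "\<forall>\<^sub>F z in at_infinity. B \<le> cmod (p z - z)" for B
    unfolding eventually_at_infinity
  proof (intro exI allI impI)
    fix z assume z: "R + 1 + \<bar>B\<bar> \<le> cmod z"
    then have "2 * cmod z \<le> cmod (p z)" using escape R_ge by simp
    then show "B \<le> cmod (p z - z)" using norm_triangle_ineq2[of "p z" z] z R_ge by linarith
  qed
  ultimately obtain z where "p z - z = 0" using Liouville_weak_inverse by blast
  then show ?thesis by auto
qed

lemma dist_AtInf_ge:
  assumes "cmod u \<le> B"
  shows "sqrt (4 / (1 + B\<^sup>2)) \<le> dist (Aff u) AtInf"
proof -
  have "(cmod u)\<^sup>2 \<le> B\<^sup>2" using assms by (intro power_mono) auto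
  then have "4 / (1 + B\<^sup>2) \<le> 4 / (1 + (cmod u)\<^sup>2)"
    by (intro divide_left_mono mult_pos_pos) (auto intro: add_pos_nonneg)
  then have "sqrt (4 / (1 + B\<^sup>2)) \<le> norm (stereo (Aff u) - stereo AtInf)"
    unfolding chord_AtInf_sq[symmetric] by (simp add: real_le_lsqrt)
  also have "\<dots> \<le> dist (Aff u) AtInf" by (rule chord_le_dist)
  finally show ?thesis .
qed

text \<open>A boundary point of the set of bounded orbits is a limit of points that escape. A locally uniform
limit of iterates would be infinite at the latter but stay at a positive distance from infinity at
the former, although the iterates are continuous. That \<open>J\<close> is nonempty matters for the
stable set: \<open>infdist\<close> to the empty set is 0, so an empty \<open>J\<close> would attract everything.\<close>

lemma J_nonempty: "J \<noteq> {}"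
proof -
  define K where "K = {z. \<forall>n. cmod ((p ^^ n) z) \<le> R}"
  have K_bd: "cmod z \<le> R" if "z \<in> K" for z using that unfolding K_def by (auto dest: spec[of _ 0])
  obtain c where c: "p c = c" using exists_fixed_point by blast
  have "(p ^^ n) c = c" for n by (induction n) (auto simp: c)
  moreover have "cmod c \<le> R" using escape[of c] c R_ge by fastforce
  ultimately have "c \<in> K" by (auto simp: K_def)
  moreover have "K \<noteq> UNIV" using K_bd[of "of_real (R + 1)"] R_ge by (auto simp del: of_real_add)
  ultimately have "frontier K \<noteq> {}" using frontier_not_empty by blast
  then obtain z where z: "z \<in> frontier K" by blast
  have "K = (\<Inter>n. (p ^^ n) -` cball 0 R)" by (auto simp: K_def)
  moreover have "closed ((p ^^ n) -` cball 0 R)" for n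
    using continuous_funpow[of UNIV n] by (simp add: continuous_on_closed_vimage)
  ultimately have "closed K" by auto
  then have zK: "z \<in> K" using z by (auto simp: frontier_def)
  have "Aff z \<notin> fatou_set P"
  proof
    assume "Aff z \<in> fatou_set P"
    then obtain U where U: "open U" "Aff z \<in> U" "normal_family_on U (range (\<lambda>n. P ^^ n))"
      by (auto simp: fatou_set_def)
    have "open (Aff -` U)"
      using U continuous_on_Aff[of UNIV] by (simp add: continuous_on_open_vimage)
    then obtain e where e: "e > 0" "cball z e \<subseteq> Aff -` U"
      using U(2) open_contains_cball by (metis vimageI)
    define C where "C = Aff ` cball z e"
    have "compact C" "C \<subseteq> U"
      unfolding C_def using e by (auto intro: compact_continuous_image continuous_on_Aff)
    then obtain \<tau> :: "nat \<Rightarrow> nat" and G where \<tau>: "strict_mono \<tau>"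
      and lim: "uniform_limit C (\<lambda>k. P ^^ \<tau> k) G sequentially"
      using normal_family_onD[OF U(3), of "\<lambda>k. P ^^ k"] by blast
    define s where "s = sqrt (4 / (1 + R\<^sup>2))"
    have "s > 0" unfolding s_def by (intro real_sqrt_gt_zero divide_pos_pos add_pos_nonneg) auto
    then have "\<forall>\<^sub>F k in sequentially. \<forall>x\<in>C. dist ((P ^^ \<tau> k) x) (G x) < s / 3"
      by (intro uniform_limitD[OF lim]) auto
    then obtain k where k: "\<forall>x\<in>C. dist ((P ^^ \<tau> k) x) (G x) < s / 3"
      by (auto simp: eventually_sequentially)
    have "continuous_on UNIV (Aff \<circ> (p ^^ \<tau> k))"
      by (intro continuous_on_compose continuous_funpow continuous_on_Aff)
    then have "\<forall>\<epsilon>>0. \<exists>d>0. \<forall>w. dist w z < d \<longrightarrow>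
        dist (Aff ((p ^^ \<tau> k) w)) (Aff ((p ^^ \<tau> k) z)) < \<epsilon>"
      unfolding continuous_on_iff by simp
    moreover have "s / 3 > 0" using \<open>s > 0\<close> by simp
    ultimately obtain d where d: "d > 0"
      "\<And>w. dist w z < d \<Longrightarrow> dist (Aff ((p ^^ \<tau> k) w)) (Aff ((p ^^ \<tau> k) z)) < s / 3" by blast
    have "\<forall>\<epsilon>>0. \<exists>x. x \<notin> K \<and> dist z x < \<epsilon>" using z by (simp add: frontier_straddle)
    moreover have "min d e > 0" using d(1) e(1) by simp
    ultimately obtain w where "w \<notin> K" "dist z w < min d e" by blast
    then have w: "dist z w < d" "dist z w < e" "w \<notin> K" by auto
    then obtain n where n: "R < cmod ((p ^^ n) w)" by (auto simp: K_def not_le)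
    have wC: "Aff w \<in> C" using w by (auto simp: C_def)
    have "(\<lambda>k. (P ^^ \<tau> k) (Aff w)) \<longlonglongrightarrow> AtInf"
      unfolding tendsto_iff
    proof (intro allI impI)
      fix \<epsilon> :: real assume "\<epsilon> > 0"
      then obtain B where B: "B > 0" "\<And>u. cmod u > B \<Longrightarrow> dist (Aff u) AtInf < \<epsilon>"
        using dist_AtInf_small by blast
      obtain N :: nat where N: "B < 2 ^ N" using real_arch_pow[of 2 B] by auto
      have "dist ((P ^^ \<tau> k) (Aff w)) AtInf < \<epsilon>" if "k \<ge> N + n" for k
      proof -
        have "\<tau> k \<ge> N + n" using seq_suble[OF \<tau>, of k] that by linarith
        then obtain j where j: "\<tau> k = j + n" "j \<ge> N"
          by (intro that[of "\<tau> k - n"]) auto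
        have "(2::real) ^ N * 1 \<le> 2 ^ j * cmod ((p ^^ n) w)"
          using n R_ge j by (intro mult_mono power_increasing) auto
        then have "B < cmod ((p ^^ \<tau> k) w)"
          using escape_funpow[OF n, of j] N j by (simp add: funpow_add)
        then show ?thesis using B(2) by (simp add: funpow_Aff)
      qed
      then show "\<forall>\<^sub>F k in sequentially. dist ((P ^^ \<tau> k) (Aff w)) AtInf < \<epsilon>"
        by (auto simp: eventually_sequentially)
    qed
    moreover have "(\<lambda>k. (P ^^ \<tau> k) (Aff w)) \<longlonglongrightarrow> G (Aff w)"
      using lim wC by (rule tendsto_uniform_limitI)
    ultimately have "G (Aff w) = AtInf" using LIMSEQ_unique by blast
    then have "dist (Aff ((p ^^ \<tau> k) w)) AtInf < s / 3"
      using k wC by (metis funpow_Aff)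
    moreover have "dist (Aff ((p ^^ \<tau> k) w)) (Aff ((p ^^ \<tau> k) z)) < s / 3"
      using d(2) w by (simp add: dist_commute)
    moreover have "s \<le> dist (Aff ((p ^^ \<tau> k) z)) AtInf"
      unfolding s_def using zK by (intro dist_AtInf_ge) (auto simp: K_def)
    ultimately show False
      using dist_triangle3[of "Aff ((p ^^ \<tau> k) z)" AtInf "Aff ((p ^^ \<tau> k) w)"] \<open>s > 0\<close> by linarith
  qed
  then show ?thesis by (auto simp: J_def julia_set_def)
qed

text \<open>If the iterates are normal near \<open>w\<close>, they are normal near \<open>p w\<close>: \<open>p\<close> is open, so a neighbourhood of
\<open>p w\<close> consists of values of \<open>p\<close>, and \<open>P^m\<close> there is \<open>P^(m + 1)\<close> at a preimage.\<close>

lemma J_backward_step: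
  assumes "p w \<in> J"
  shows "w \<in> J"
proof (rule ccontr)
  assume "w \<notin> J"
  then obtain U where U: "open U" "Aff w \<in> U" "normal_family_on U (range (\<lambda>n. P ^^ n))"
    by (auto simp: J_def julia_set_def fatou_set_def)
  have "open (Aff -` U)"
    using U continuous_on_Aff[of UNIV] by (simp add: continuous_on_open_vimage)
  then obtain e where e: "e > 0" "cball w e \<subseteq> Aff -` U"
    using U(2) open_contains_cball by (metis vimageI)
  define C where "C = Aff ` cball w e"
  have C: "compact C" "C \<subseteq> U"
    unfolding C_def using e by (auto intro: compact_continuous_image continuous_on_Aff)
  define U' where "U' = Aff ` (p ` ball w e)"
  have "open (p ` ball w e)" using open_funpow_image[of "ball w e" 1] by simp
  then have "open U'" unfolding U'_def by (rule open_Aff_image)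
  moreover have "Aff (p w) \<in> U'" using e by (auto simp: U'_def)
  moreover have "normal_family_on U' (range (\<lambda>n. P ^^ n))"
    unfolding normal_family_on_def
  proof (intro allI impI)
    fix g :: "nat \<Rightarrow> riemann_sphere \<Rightarrow> riemann_sphere" assume "range g \<subseteq> range (\<lambda>n. P ^^ n)"
    then have "\<forall>k. \<exists>n. g k = P ^^ n" by blast
    then obtain m where m: "g k = P ^^ m k" for k by metis
    have "range (\<lambda>k. P ^^ Suc (m k)) \<subseteq> range (\<lambda>n. P ^^ n)" by blast
    then obtain \<tau> :: "nat \<Rightarrow> nat" and G where \<tau>: "strict_mono \<tau>"
      and lim: "uniform_limit C (\<lambda>k. P ^^ Suc (m (\<tau> k))) G sequentially"
      using normal_family_onD[OF U(3) _ C] by blast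
    have "\<forall>y\<in>U'. \<exists>u\<in>C. y = P u" by (force simp: U'_def C_def)
    then obtain pre where pre: "\<And>y. y \<in> U' \<Longrightarrow> pre y \<in> C \<and> y = P (pre y)" by metis
    have "uniform_limit U' (\<lambda>k. g (\<tau> k)) (\<lambda>y. G (pre y)) sequentially"
    proof (rule uniform_limitI)
      fix \<epsilon> :: real assume "\<epsilon> > 0"
      then have "\<forall>\<^sub>F k in sequentially. \<forall>x\<in>C. dist ((P ^^ Suc (m (\<tau> k))) x) (G x) < \<epsilon>"
        by (rule uniform_limitD[OF lim])
      then show "\<forall>\<^sub>F k in sequentially. \<forall>x\<in>U'. dist (g (\<tau> k) x) (G (pre x)) < \<epsilon>"
      proof (rule eventually_mono)
        fix k assume k: "\<forall>x\<in>C. dist ((P ^^ Suc (m (\<tau> k))) x) (G x) < \<epsilon>"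
        show "\<forall>x\<in>U'. dist (g (\<tau> k) x) (G (pre x)) < \<epsilon>"
        proof
          fix x assume "x \<in> U'"
          then have "pre x \<in> C" "x = P (pre x)" using pre by auto
          moreover have "(P ^^ Suc (m (\<tau> k))) (pre x) = (P ^^ m (\<tau> k)) (P (pre x))"
            by (simp add: funpow_swap1)
          ultimately show "dist (g (\<tau> k) x) (G (pre x)) < \<epsilon>" using k m by metis
        qed
      qed
    qed
    then show "\<exists>\<tau> G. strict_mono \<tau> \<and>
           (\<forall>K. compact K \<and> K \<subseteq> U' \<longrightarrow> uniform_limit K (\<lambda>k. g (\<tau> k)) G sequentially)"
      using \<tau>(1) uniform_limit_on_subset by blast
  qed
  ultimately show False using assms by (auto simp: J_def julia_set_def fatou_set_def)
qed

lemma J_backward: "(p ^^ k) w \<in> J \<Longrightarrow> w \<in> J"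
  by (induction k) (auto dest: J_backward_step)

text \<open>The image of a component is open because iterates are open maps, and closed in \<open>V\<close> because they are
proper: preimages of bounded sets are bounded.\<close>

lemma component_of_preimage_onto:
  assumes V: "open V" "connected V" "bounded V" and u: "(p ^^ k) u \<in> V"
  shows "(p ^^ k) ` connected_component_set ((p ^^ k) -` V) u = V"
proof -
  define S where "S = (p ^^ k) -` V"
  define W where "W = connected_component_set S u"
  define T where "T = (p ^^ k) ` W"
  have "open S"
    unfolding S_def using V(1) continuous_funpow[of UNIV k] by (simp add: continuous_on_open_vimage)
  then have "open W" unfolding W_def by (rule open_connected_component)
  then have "open T" unfolding T_def by (rule open_funpow_image)
  have WS: "W \<subseteq> S" unfolding W_def by (rule connected_component_subset)
  then have TV: "T \<subseteq> V" by (auto simp: T_def S_def)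
  have "u \<in> W" unfolding W_def using u by (simp add: S_def connected_component_refl)
  then have "T \<noteq> {}" by (auto simp: T_def)
  have "closedin (top_of_set S) W" unfolding W_def by (rule closedin_connected_component)
  then obtain F where F: "closed F" "W = S \<inter> F" by (auto simp: closedin_closed)
  have "V \<inter> closure T \<subseteq> T"
  proof
    fix y assume y: "y \<in> V \<inter> closure T"
    then obtain t where t: "\<And>n. t n \<in> T" "t \<longlonglongrightarrow> y" by (auto simp: closure_sequential)
    have "\<forall>n. \<exists>w\<in>W. t n = (p ^^ k) w" using t(1) by (auto simp: T_def)
    then obtain w where w: "\<And>n. w n \<in> W" "\<And>n. t n = (p ^^ k) (w n)" by metis
    obtain B where B: "\<And>x. x \<in> V \<Longrightarrow> cmod x \<le> B" using V(3) by (auto simp: bounded_iff)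
    have "cmod (w n) \<le> max B R" for n
      using norm_le_if_funpow_norm_le[of k "w n" "max B R"] B[of "t n"] w(2)[of n] t(1)[of n] TV by auto
    then have "bounded (range w)" by (auto simp: bounded_iff)
    then obtain v r where v: "strict_mono (r::nat\<Rightarrow>nat)" "(w \<circ> r) \<longlonglongrightarrow> v"
      using bounded_imp_convergent_subsequence by blast
    have "isCont (p ^^ k) v"
      using continuous_funpow[of UNIV k] by (simp add: continuous_on_eq_continuous_at)
    then have "(\<lambda>n. (p ^^ k) ((w \<circ> r) n)) \<longlonglongrightarrow> (p ^^ k) v"
      using v(2) by (rule isCont_tendsto_compose)
    then have "(t \<circ> r) \<longlonglongrightarrow> (p ^^ k) v" using w(2) by (simp add: o_def)
    moreover have "(t \<circ> r) \<longlonglongrightarrow> y" using t(2) v(1) by (rule LIMSEQ_subseq_LIMSEQ)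
    ultimately have "(p ^^ k) v = y" using LIMSEQ_unique by blast
    moreover have "v \<in> F"
      using F v(2) w(1) by (intro closed_sequentially[OF F(1), of "w \<circ> r" v]) auto
    ultimately show "y \<in> T" using y F by (auto simp: T_def S_def)
  qed
  then have "T = V \<inter> closure T" using TV closure_subset by blast
  then have "closedin (top_of_set V) T" by (metis closed_closure closedin_closed_Int)
  moreover have "openin (top_of_set V) T" using \<open>open T\<close> TV by (simp add: openin_open_eq V(1))
  ultimately have "T = V" using V(2) \<open>T \<noteq> {}\<close> by (metis connected_clopen)
  then show ?thesis by (simp add: T_def W_def S_def)
qed

text \<open>The form of TCE in which it is used: in the affine chart with the Euclidean metric, and for
arbitrary connected sets, so that no components of preimages have to be handled. The constant \<open>C\<close>
pays for the change of the metric.\<close>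

definition backward_shrinking :: "real \<Rightarrow> real \<Rightarrow> real \<Rightarrow> bool" where
  "backward_shrinking \<mu> \<rho> C \<longleftrightarrow> (\<forall>y\<in>J. \<forall>n S. connected S \<and> (p ^^ n) ` S \<subseteq> ball y \<rho> \<longrightarrow>
     (\<forall>u\<in>S. \<forall>v\<in>S. dist u v \<le> C / \<mu> ^ n))"

text \<open>A connected set lies in one component, and the affine and the spherical metric are comparable
on the bounded set of points that an iterate takes near \<open>J\<close>.\<close>

lemma TCE_imp_backward_shrinking:
  assumes "TCE P \<mu>"
  shows "\<exists>\<rho>>0. \<exists>C>0. backward_shrinking \<mu> \<rho> C"
proof -
  obtain r where r: "r > 0"
    "\<And>y n W. y \<in> julia_set P \<Longrightarrow> W \<in> components ((P ^^ n) -` ball y r) \<Longrightarrow> diameter W \<le> 1 / \<mu> ^ n"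
    using assms by (auto simp: TCE_def)
  obtain e where e: "e > 0" "\<And>u v. cmod (u - v) < e \<Longrightarrow> dist (Aff u) (Aff v) < r"
    using uniformly_continuous_Aff[OF r(1)] by blast
  define C where "C = 1 + (R + 1)\<^sup>2"
  have "dist u v \<le> C / \<mu> ^ n"
    if y: "y \<in> J" and S: "connected S" "(p ^^ n) ` S \<subseteq> ball y (min e 1)" and uv: "u \<in> S" "v \<in> S" for y n S u v
  proof -
    have sub: "Aff ` S \<subseteq> (P ^^ n) -` ball (Aff y) r"
      using S(2) e(2) by (fastforce simp: funpow_Aff dist_norm)
    moreover have "connected (Aff ` S)"
      using S(1) by (intro connected_continuous_image continuous_on_Aff)
    ultimately obtain W where W: "W \<in> components ((P ^^ n) -` ball (Aff y) r)" "Aff ` S \<subseteq> W"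
      using exists_component_superset uv(1) by (metis image_is_empty empty_iff subset_empty)
    have "bounded W"
      unfolding bounded_def using sphere_dist_bounds(2) by blast
    then have "dist (Aff u) (Aff v) \<le> diameter W"
      using W uv by (intro diameter_bounded_bound) auto
    also have "\<dots> \<le> 1 / \<mu> ^ n" using r(2)[of "Aff y" W n] W y by (simp add: J_def)
    finally have *: "dist (Aff u) (Aff v) \<le> 1 / \<mu> ^ n" .
    have bd: "cmod x \<le> R + 1" if "x \<in> S" for x
    proof (rule norm_le_if_funpow_norm_le)
      have "dist y ((p ^^ n) x) < 1" using S(2) that by auto
      then show "cmod ((p ^^ n) x) \<le> R + 1"
        using J_bounded[OF y] norm_triangle_ineq2[of "(p ^^ n) x" y] by (simp add: dist_norm norm_minus_commute)
    qed simp
    have "dist u v \<le> C * dist (Aff u) (Aff v)"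
      unfolding C_def dist_norm[of u v] using bd uv by (intro norm_diff_le_dist_Aff)
    also have "\<dots> \<le> C * (1 / \<mu> ^ n)"
      using * by (intro mult_left_mono) (auto simp: C_def)
    finally show ?thesis by simp
  qed
  then have "backward_shrinking \<mu> (min e 1) C" unfolding backward_shrinking_def by blast
  moreover have "C > 0" unfolding C_def by (intro add_pos_nonneg) auto
  ultimately show ?thesis using e(1) by (intro exI[of _ "min e 1"]) auto
qed

text \<open>The component of the preimage of the disk that contains \<open>u\<close> also contains a preimage of \<open>y\<close>, which
is in \<open>J\<close>, and this component is small.\<close>

lemma backward_shrinking_near_J:
  assumes "backward_shrinking \<mu> \<rho> C" "y \<in> J" "dist y ((p ^^ k) u) < \<rho>"
  shows "\<exists>w\<in>J. dist u w \<le> C / \<mu> ^ k"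
proof -
  define S where "S = (p ^^ k) -` ball y \<rho>"
  define W where "W = connected_component_set S u"
  have "\<rho> > 0" using assms(3) zero_le_dist[of y "(p ^^ k) u"] by linarith
  have "(p ^^ k) ` W = ball y \<rho>"
    unfolding W_def S_def using assms(3) by (intro component_of_preimage_onto) auto
  then obtain w where w: "w \<in> W" "(p ^^ k) w = y" using \<open>\<rho> > 0\<close> by (metis centre_in_ball imageE)
  have "u \<in> W" unfolding W_def S_def using assms(3) by (simp add: connected_component_refl)
  moreover have "connected W" by (simp add: W_def)
  moreover have "(p ^^ k) ` W \<subseteq> ball y \<rho>" using \<open>(p ^^ k) ` W = ball y \<rho>\<close> by simp
  ultimately have "dist u w \<le> C / \<mu> ^ k"
    using assms(1,2) w(1) unfolding backward_shrinking_def by blast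
  moreover have "w \<in> J" using J_backward[of k w] w assms(2) by simp
  ultimately show ?thesis by blast
qed

end

section \<open>Pseudo-orbits\<close>

text \<open>The distances \<open>e m\<close> satisfy \<open>e (m + 1) \<le> M e m + \<epsilon>\<close>, hence \<open>e m \<le> (2 M^m - 1) \<epsilon>\<close> for \<open>M \<ge> 2\<close>.
The smallness condition keeps the true orbit in the disk on which \<open>M\<close> is a Lipschitz constant.\<close>

lemma pseudo_orbit_shadowing:
  fixes p :: "complex \<Rightarrow> complex"
  assumes lip: "\<And>u v. cmod u \<le> B + 1 \<Longrightarrow> cmod v \<le> B + 1 \<Longrightarrow> dist (p u) (p v) \<le> M * dist u v"
    and M: "2 \<le> M"
    and err: "\<And>m. m < N \<Longrightarrow> dist (p (u m)) (u (Suc m)) \<le> \<epsilon>"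
    and bd: "\<And>m. m \<le> N \<Longrightarrow> cmod (u m) \<le> B"
    and start: "dist w (u 0) \<le> \<epsilon>" and small: "M ^ N * (2 * \<epsilon>) \<le> 1"
    and m: "m \<le> N"
  shows "dist ((p ^^ m) w) (u m) \<le> M ^ m * (2 * \<epsilon>)"
proof -
  have \<epsilon>: "0 \<le> \<epsilon>" using start zero_le_dist[of w "u 0"] by linarith
  have "dist ((p ^^ m) w) (u m) \<le> (2 * M ^ m - 1) * \<epsilon>"
    using m
  proof (induction m)
    case (Suc m)
    then have IH: "dist ((p ^^ m) w) (u m) \<le> (2 * M ^ m - 1) * \<epsilon>" by simp
    have "M ^ m * (2 * \<epsilon>) \<le> M ^ N * (2 * \<epsilon>)"
      using Suc.prems M \<epsilon> by (intro mult_right_mono power_increasing) auto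
    then have "dist ((p ^^ m) w) (u m) \<le> 1" using IH small \<epsilon> by (simp add: algebra_simps)
    then have "cmod ((p ^^ m) w) \<le> B + 1"
      using bd[of m] Suc.prems norm_triangle_ineq2[of "(p ^^ m) w" "u m"] by (simp add: dist_norm)
    moreover have "cmod (u m) \<le> B + 1" using bd[of m] Suc.prems by simp
    ultimately have "dist (p ((p ^^ m) w)) (p (u m)) \<le> M * dist ((p ^^ m) w) (u m)" by (rule lip)
    also have "\<dots> \<le> M * ((2 * M ^ m - 1) * \<epsilon>)" using IH M by (intro mult_left_mono) auto
    finally have "dist (p ((p ^^ m) w)) (u (Suc m)) \<le> M * ((2 * M ^ m - 1) * \<epsilon>) + \<epsilon>"
      using dist_triangle[of "p ((p ^^ m) w)" "u (Suc m)" "p (u m)"] err[of m] Suc.prems by simp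
    also have "\<dots> \<le> (2 * M ^ Suc m - 1) * \<epsilon>"
      using mult_right_mono[OF M \<epsilon>] by (simp add: algebra_simps)
    finally show ?case by simp
  qed (use start in simp)
  also have "\<dots> \<le> M ^ m * (2 * \<epsilon>)" using \<epsilon> by (simp add: algebra_simps)
  finally show ?thesis .
qed

context escaping_entire
begin

text \<open>There is a number \<open>K\<close> such that \<open>p^K\<close> takes every point at distance at least \<open>min d (\<rho>/2)\<close> from \<open>J\<close>
to distance at least \<open>\<rho>\<close>. A pseudo-orbit with small errors is then at distance at least
\<open>\<rho>/2\<close> at every positive multiple of \<open>K\<close>.\<close>

lemma pseudo_orbit_off_J:
  assumes shr: "backward_shrinking \<mu> \<rho> C" and \<mu>: "1 < \<mu>" and \<rho>: "0 < \<rho>"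
    and lip: "\<And>u v. cmod u \<le> R + 1 \<Longrightarrow> cmod v \<le> R + 1 \<Longrightarrow> dist (p u) (p v) \<le> M * dist u v"
    and M: "2 \<le> M" and d: "0 < d"
  shows "\<exists>\<epsilon>>0. \<forall>c u. d \<le> infdist c J \<longrightarrow> dist c (u 0) \<le> \<epsilon> \<longrightarrow>
     (\<forall>m. dist (p (u m)) (u (Suc m)) \<le> \<epsilon>) \<longrightarrow> (\<forall>m. cmod (u m) \<le> R) \<longrightarrow>
     \<not> (\<lambda>m. infdist (u m) J) \<longlonglongrightarrow> 0"
proof -
  define d1 where "d1 = min d (\<rho> / 2)"
  have d1: "d1 > 0" using d \<rho> by (simp add: d1_def)
  have "(\<lambda>n. C * (1 / \<mu>) ^ n) \<longlonglongrightarrow> C * 0"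
    using \<mu> by (intro tendsto_intros LIMSEQ_power_zero) auto
  then have "\<forall>\<^sub>F n in sequentially. C * (1 / \<mu>) ^ n < d1"
    using d1 by (intro order_tendstoD) auto
  then obtain K0 where K0: "\<And>n. n \<ge> K0 \<Longrightarrow> C * (1 / \<mu>) ^ n < d1"
    by (auto simp: eventually_sequentially)
  define K where "K = Suc K0"
  have CK: "C / \<mu> ^ K < d1" using K0[of K] by (simp add: K_def power_one_over divide_simps)
  have away: "\<rho> \<le> infdist ((p ^^ K) x) J" if x: "d1 \<le> infdist x J" for x
  proof (rule ccontr)
    assume *: "\<not> \<rho> \<le> infdist ((p ^^ K) x) J"
    obtain y where y: "y \<in> J" "infdist ((p ^^ K) x) J = dist ((p ^^ K) x) y"
      using infdist_attains_inf[OF closed_J J_nonempty] by blast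
    then obtain w where w: "w \<in> J" "dist x w \<le> C / \<mu> ^ K"
      using backward_shrinking_near_J[OF shr y(1), of K x] * by (auto simp: dist_commute)
    then have "infdist x J < d1" using infdist_le[OF w(1), of x] CK by linarith
    then show False using x by simp
  qed
  define \<epsilon> where "\<epsilon> = min 1 (\<rho> / 2) / (2 * M ^ K)"
  have MK: "M ^ K > 0" using M by simp
  have \<epsilon>: "\<epsilon> > 0" unfolding \<epsilon>_def using \<rho> MK by (auto intro!: divide_pos_pos)
  have \<epsilon>_eq: "M ^ K * (2 * \<epsilon>) = min 1 (\<rho> / 2)" unfolding \<epsilon>_def using M MK by (simp add: field_simps)
  have step: "\<rho> / 2 \<le> infdist (v K) J"
    if v: "d1 \<le> infdist x J" "dist x (v 0) \<le> \<epsilon>" "\<And>m. dist (p (v m)) (v (Suc m)) \<le> \<epsilon>" "\<And>m. cmod (v m) \<le> R"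
    for x v
  proof -
    have "dist ((p ^^ K) x) (v K) \<le> M ^ K * (2 * \<epsilon>)"
      by (rule pseudo_orbit_shadowing[where B = R and N = K]) (use lip M v \<epsilon>_eq in auto)
    then have "dist ((p ^^ K) x) (v K) \<le> \<rho> / 2" using \<epsilon>_eq by simp
    then show ?thesis
      using away[OF v(1)] infdist_triangle[of "(p ^^ K) x" J "v K"] by linarith
  qed
  have "\<not> (\<lambda>m. infdist (u m) J) \<longlonglongrightarrow> 0"
    if u: "d \<le> infdist c J" "dist c (u 0) \<le> \<epsilon>" "\<forall>m. dist (p (u m)) (u (Suc m)) \<le> \<epsilon>" "\<forall>m. cmod (u m) \<le> R"
    for c u
  proof
    assume "(\<lambda>m. infdist (u m) J) \<longlonglongrightarrow> 0"
    then have "\<forall>\<^sub>F m in sequentially. infdist (u m) J < \<rho> / 2"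
      using \<rho> by (intro order_tendstoD) auto
    then obtain m0 where m0: "\<And>m. m \<ge> m0 \<Longrightarrow> infdist (u m) J < \<rho> / 2"
      by (auto simp: eventually_sequentially)
    have "\<rho> / 2 \<le> infdist (u (Suc n * K)) J" for n
    proof (induction n)
      case 0
      have "d1 \<le> infdist c J" using u(1) by (simp add: d1_def)
      from step[OF this, of u] u show ?case by simp
    next
      case (Suc n)
      have "d1 \<le> infdist (u (Suc n * K)) J" using Suc by (simp add: d1_def)
      from step[OF this, of "\<lambda>m. u (Suc n * K + m)"] u \<epsilon> show ?case by (simp add: algebra_simps)
    qed
    from this[of m0] m0[of "Suc m0 * K"] show False by (simp add: K_def)
  qed
  then show ?thesis using \<epsilon> by blast
qed

end

section \<open>Inverse branches of nonautonomous compositions\<close>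

text \<open>A quantitative inverse function theorem. On the disk of radius \<open>\<kappa> / (2 B)\<close> the derivative differs
from \<open>deriv f a\<close> by at most \<open>\<kappa> / 2\<close>, so \<open>f\<close> is injective there; the size of the image is given by
Bloch's lemma, with \<open>3 - 2 * sqrt 2 \<ge> 1 / 6\<close>.\<close>

lemma inverse_branch_on_ball:
  assumes holo: "f holomorphic_on UNIV" and \<kappa>: "0 < \<kappa>" "\<kappa> \<le> B" "\<kappa> \<le> cmod (deriv f a)"
    and lip: "\<And>u. u \<in> ball a 1 \<Longrightarrow> cmod (deriv f u - deriv f a) \<le> B * dist u a"
  obtains g where "g holomorphic_on ball (f a) (\<kappa>\<^sup>2 / (12 * B))" "g (f a) = a"
    "\<And>w. w \<in> ball (f a) (\<kappa>\<^sup>2 / (12 * B)) \<Longrightarrow> f (g w) = w \<and> g w \<in> ball a 1"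
proof -
  define r where "r = \<kappa> / (2 * B)"
  have B: "B > 0" using \<kappa> by linarith
  have r: "0 < r" "r \<le> 1/2" using \<kappa> B by (auto simp: r_def field_simps)
  have near: "cmod (deriv f u - deriv f a) \<le> \<kappa> / 2" if "u \<in> ball a r" for u
  proof -
    have "dist u a \<le> r" "u \<in> ball a 1" using that r by (auto simp: dist_commute)
    then have "cmod (deriv f u - deriv f a) \<le> B * r"
      using lip[of u] B mult_left_mono[of "dist u a" r B] by linarith
    then show ?thesis using B by (simp add: r_def)
  qed
  have der: "(f has_field_derivative deriv f u) (at u)" for u
    using holo by (simp add: holomorphic_derivI)
  have inj: "inj_on f (ball a r)"
  proof (rule inj_onI)
    fix u v assume uv: "u \<in> ball a r" "v \<in> ball a r" "f u = f v"
    have "cmod ((f u - deriv f a * u) - (f v - deriv f a * v)) \<le> \<kappa> / 2 * cmod (u - v)"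
    proof (rule field_differentiable_bound[where S = "ball a r" and f' = "\<lambda>z. deriv f z - deriv f a"])
      fix z assume z: "z \<in> ball a r"
      show "((\<lambda>z. f z - deriv f a * z) has_field_derivative deriv f z - deriv f a) (at z within ball a r)"
        by (auto intro!: derivative_eq_intros DERIV_subset[OF der])
      show "cmod (deriv f z - deriv f a) \<le> \<kappa> / 2" by (rule near[OF z])
    qed (use uv in auto)
    also have "(f u - deriv f a * u) - (f v - deriv f a * v) = - (deriv f a * (u - v))"
      using uv(3) by (simp add: algebra_simps)
    finally have "cmod (deriv f a) * cmod (u - v) \<le> \<kappa> / 2 * cmod (u - v)" by (simp add: norm_mult)
    moreover have "\<kappa> * cmod (u - v) \<le> cmod (deriv f a) * cmod (u - v)"
      using \<kappa> by (intro mult_right_mono) auto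
    ultimately have "\<kappa> * cmod (u - v) \<le> 0" by simp
    then show "u = v" using \<kappa>(1) by (simp add: mult_le_0_iff)
  qed
  have "ball (f a) ((3 - 2 * sqrt 2) * r * cmod (deriv f a)) \<subseteq> f ` ball a r"
  proof (rule Bloch_lemma)
    show "f holomorphic_on cball a r" using holo holomorphic_on_subset by blast
    fix z assume "z \<in> ball a r"
    then show "cmod (deriv f z) \<le> 2 * cmod (deriv f a)"
      using near[of z] norm_triangle_ineq2[of "deriv f z" "deriv f a"] \<kappa> by linarith
  qed (rule r)
  moreover have "\<kappa>\<^sup>2 / (12 * B) \<le> (3 - 2 * sqrt 2) * r * cmod (deriv f a)"
  proof -
    have "sqrt 2 \<le> 17 / 12" by (rule real_le_lsqrt) (auto simp: power2_eq_square)
    then have "1 / 6 \<le> 3 - 2 * sqrt 2" by simp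
    then have "(1 / 6) * r * \<kappa> \<le> (3 - 2 * sqrt 2) * r * cmod (deriv f a)"
      using r \<kappa> by (intro mult_mono mult_right_mono) auto
    then show ?thesis using B by (simp add: r_def power2_eq_square field_simps)
  qed
  ultimately have img: "ball (f a) (\<kappa>\<^sup>2 / (12 * B)) \<subseteq> f ` ball a r"
    using subset_ball by blast
  obtain g where g: "g holomorphic_on (f ` ball a r)" "\<And>z. z \<in> ball a r \<Longrightarrow> g (f z) = z"
    using holomorphic_has_inverse[of f "ball a r"] inj holo holomorphic_on_subset by (metis open_ball subset_UNIV)
  show thesis
  proof
    show "g holomorphic_on ball (f a) (\<kappa>\<^sup>2 / (12 * B))" using g(1) img holomorphic_on_subset by blast
    show "g (f a) = a" using g(2) r by simp
    fix w assume "w \<in> ball (f a) (\<kappa>\<^sup>2 / (12 * B))"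
    then obtain v where "w = f v" "v \<in> ball a r" using img by blast
    then show "f (g w) = w \<and> g w \<in> ball a 1" using g(2)[of v] r by auto
  qed
qed

primrec iter_from :: "(nat \<Rightarrow> 'a \<Rightarrow> 'a) \<Rightarrow> nat \<Rightarrow> nat \<Rightarrow> 'a \<Rightarrow> 'a" where
  "iter_from H j 0 u = u"
| "iter_from H j (Suc m) u = H (j + m) (iter_from H j m u)"

lemma iter_from_Suc_left: "iter_from H j (Suc m) u = iter_from H (Suc j) m (H j u)"
  by (induction m) auto

lemma iter_from_orbit: "(\<And>n. z (Suc n) = H n (z n)) \<Longrightarrow> iter_from H j m (z j) = z (j + m)"
  by (induction m) auto

lemma iter_from_has_field_derivative:
  assumes "\<And>n. H n holomorphic_on UNIV"
  shows "(iter_from H j m has_field_derivative (\<Prod>l<m. deriv (H (j + l)) (iter_from H j l u))) (at u)"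
proof (induction m)
  case 0
  have "iter_from H j 0 = (\<lambda>u. u)" by auto
  then show ?case by simp
next
  case (Suc m)
  have "(H (j + m) has_field_derivative deriv (H (j + m)) (iter_from H j m u)) (at (iter_from H j m u))"
    using assms by (intro holomorphic_derivI[OF _ open_UNIV]) auto
  from DERIV_chain[OF this Suc]
  have "(H (j + m) \<circ> iter_from H j m has_field_derivative
      deriv (H (j + m)) (iter_from H j m u) * (\<Prod>l<m. deriv (H (j + l)) (iter_from H j l u))) (at u)" .
  moreover have "H (j + m) \<circ> iter_from H j m = iter_from H j (Suc m)" by auto
  ultimately show ?case by (simp add: mult.commute del: iter_from.simps)
qed

text \<open>The inverse branch \<open>\<phi>\<close> along the block is built backwards from its end. By \<open>shrink\<close> the image of the
branch for the last \<open>m\<close> maps is so small that the local inverse of the preceding map is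
defined on it, which gives the branch for \<open>m + 1\<close> maps. The full branch maps a disk of radius \<open>s\<close>
into one of radius \<open>\<sigma> k\<close>, so the Cauchy inequality bounds its derivative above, and hence the derivative
of the block below. The bound \<open>R'\<close> on the intermediate points is carried along because
\<open>shrink\<close> needs it to compare \<open>H\<close> with a fixed map.\<close>

lemma derivative_lower_bound_from_inverse_branch:
  fixes H :: "nat \<Rightarrow> complex \<Rightarrow> complex"
  assumes holo: "\<And>n. H n holomorphic_on UNIV" and z: "\<And>n. z (Suc n) = H n (z n)"
    and \<kappa>: "0 < \<kappa>" "\<kappa> \<le> B"
    and der: "\<And>j. i \<le> j \<Longrightarrow> j < i + k \<Longrightarrow> \<kappa> \<le> cmod (deriv (H j) (z j))"
    and lip: "\<And>j u. i \<le> j \<Longrightarrow> j < i + k \<Longrightarrow> u \<in> ball (z j) 1 \<Longrightarrow>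
        cmod (deriv (H j) u - deriv (H j) (z j)) \<le> B * dist u (z j)"
    and s: "0 < s" "s \<le> 1" and bd: "\<And>j. cmod (z j) + 1 \<le> R'"
    and shrink: "\<And>m S u. \<lbrakk>m \<le> k; connected S; z (i + k - m) \<in> S;
        \<And>u l. u \<in> S \<Longrightarrow> l \<le> m \<Longrightarrow> cmod (iter_from H (i + k - m) l u) \<le> R';
        iter_from H (i + k - m) m ` S \<subseteq> ball (z (i + k)) s; u \<in> S\<rbrakk> \<Longrightarrow> dist u (z (i + k - m)) \<le> \<sigma> m"
    and \<sigma>: "\<And>m. m \<le> k \<Longrightarrow> 0 < \<sigma> m \<and> \<sigma> m < \<kappa>\<^sup>2 / (12 * B)"
  shows "s / (2 * \<sigma> k) \<le> cmod (\<Prod>l<k. deriv (H (i + l)) (z (i + l)))"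
proof -
  define D where "D = ball (z (i + k)) s"
  define good where "good m \<phi> \<longleftrightarrow> \<phi> holomorphic_on D \<and> \<phi> (z (i + k)) = z (i + k - m) \<and>
      (\<forall>w\<in>D. iter_from H (i + k - m) m (\<phi> w) = w \<and>
        (\<forall>l\<le>m. cmod (iter_from H (i + k - m) l (\<phi> w)) \<le> R'))" for m \<phi>
  have close: "dist (\<phi> w) (z (i + k - m)) \<le> \<sigma> m" if "good m \<phi>" "m \<le> k" "w \<in> D" for m \<phi> w
  proof (rule shrink[OF that(2)])
    show "connected (\<phi> ` D)"
      using that by (intro connected_continuous_image holomorphic_on_imp_continuous_on)
        (auto simp: good_def D_def)
    show "z (i + k - m) \<in> \<phi> ` D"
      using that s by (intro image_eqI[of _ _ "z (i + k)"]) (auto simp: good_def D_def)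
    show "cmod (iter_from H (i + k - m) l u) \<le> R'" if "u \<in> \<phi> ` D" "l \<le> m" for u l
      using that \<open>good m \<phi>\<close> by (auto simp: good_def)
    show "iter_from H (i + k - m) m ` \<phi> ` D \<subseteq> ball (z (i + k)) s"
      using \<open>good m \<phi>\<close> by (auto simp: good_def D_def)
  qed (use that in auto)
  have "\<exists>\<phi>. good m \<phi>" if "m \<le> k" for m
    using that
  proof (induction m)
    case 0
    have "cmod w \<le> R'" if "w \<in> D" for w
      using that bd[of "i + k"] s norm_triangle_ineq2[of w "z (i + k)"]
      by (simp add: D_def dist_norm norm_minus_commute)
    then show ?case by (intro exI[of _ "\<lambda>w. w"]) (auto simp: good_def)
  next
    case (Suc m)
    then obtain \<phi> where \<phi>: "good m \<phi>" by auto
    define j where "j = i + k - Suc m"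
    have j: "i + k - m = Suc j" "i \<le> j" "j < i + k" using Suc.prems by (auto simp: j_def)
    obtain g where g: "g holomorphic_on ball (H j (z j)) (\<kappa>\<^sup>2 / (12 * B))" "g (H j (z j)) = z j"
      "\<And>w. w \<in> ball (H j (z j)) (\<kappa>\<^sup>2 / (12 * B)) \<Longrightarrow> H j (g w) = w \<and> g w \<in> ball (z j) 1"
      using inverse_branch_on_ball[OF holo \<kappa> der[OF j(2,3)] lip[OF j(2,3)]] by blast
    have sub: "\<phi> w \<in> ball (H j (z j)) (\<kappa>\<^sup>2 / (12 * B))" if "w \<in> D" for w
      using close[OF \<phi> _ that] \<sigma>[of m] Suc.prems j(1) z[of j] by (simp add: dist_commute)
    have "good (Suc m) (g \<circ> \<phi>)"
      unfolding good_def
    proof (intro conjI ballI allI impI)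
      show "(g \<circ> \<phi>) holomorphic_on D"
        using \<phi> g(1) sub by (intro holomorphic_on_compose_gen[of \<phi> D g]) (auto simp: good_def)
      show "(g \<circ> \<phi>) (z (i + k)) = z (i + k - Suc m)"
        using \<phi> g(2) j(1) z[of j] by (simp add: good_def j_def)
      fix w assume w: "w \<in> D"
      have *: "iter_from H j (Suc l) ((g \<circ> \<phi>) w) = iter_from H (Suc j) l (\<phi> w)" for l
        unfolding iter_from_Suc_left using g(3)[OF sub[OF w]] by simp
      show "iter_from H (i + k - Suc m) (Suc m) ((g \<circ> \<phi>) w) = w"
        using * \<phi> w j(1) unfolding j_def[symmetric] by (simp add: good_def del: iter_from.simps)
      fix l assume l: "l \<le> Suc m"
      show "cmod (iter_from H (i + k - Suc m) l ((g \<circ> \<phi>) w)) \<le> R'"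
      proof (cases l)
        case 0
        have "g (\<phi> w) \<in> ball (z j) 1" using g(3)[OF sub[OF w]] by simp
        then have "cmod (g (\<phi> w)) \<le> R'"
          using bd[of j] norm_triangle_ineq2[of "g (\<phi> w)" "z j"]
          by (simp add: dist_norm norm_minus_commute)
        then show ?thesis using 0 by simp
      next
        case (Suc l')
        then show ?thesis using *[of l'] \<phi> w j(1) l unfolding j_def[symmetric]
          by (simp add: good_def del: iter_from.simps)
      qed
    qed
    then show ?case by blast
  qed
  then obtain \<phi> where \<phi>: "good k \<phi>" by blast
  define w0 where "w0 = z (i + k)"
  have hol: "\<phi> holomorphic_on D" and \<phi>0: "\<phi> w0 = z i"
    using \<phi> by (auto simp: good_def w0_def)
  have inv: "iter_from H i k (\<phi> w) = w" if "w \<in> D" for w using \<phi> that by (simp add: good_def)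
  have D: "open D" "w0 \<in> D" using s by (auto simp: D_def w0_def)
  have d\<phi>: "(\<phi> has_field_derivative deriv \<phi> w0) (at w0)"
    using hol D by (rule holomorphic_derivI)
  define \<Lambda> where "\<Lambda> = (\<Prod>l<k. deriv (H (i + l)) (z (i + l)))"
  have "(iter_from H i k has_field_derivative \<Lambda>) (at (\<phi> w0))"
    using iter_from_has_field_derivative[of H i k "z i", OF holo] iter_from_orbit[of z H, OF z]
    by (simp add: \<Lambda>_def \<phi>0)
  from DERIV_chain[OF this d\<phi>]
  have "(iter_from H i k \<circ> \<phi> has_field_derivative \<Lambda> * deriv \<phi> w0) (at w0)" .
  moreover have "(iter_from H i k \<circ> \<phi> has_field_derivative 1) (at w0)"
    by (rule has_field_derivative_transform_within_open[OF DERIV_ident D]) (simp add: inv)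
  ultimately have prod: "\<Lambda> * deriv \<phi> w0 = 1" by (rule DERIV_unique)
  \<comment> \<open>The Cauchy inequality asks for continuity on the closed disk, so half the radius is used.\<close>
  have "cmod ((deriv ^^ 1) (\<lambda>w. \<phi> w - z i) w0) \<le> fact 1 * \<sigma> k / (s / 2) ^ 1"
  proof (rule Cauchy_inequality)
    have sub: "cball w0 (s / 2) \<subseteq> D" using s by (auto simp: D_def w0_def)
    then have "(\<lambda>w. \<phi> w - z i) holomorphic_on cball w0 (s / 2)"
      by (intro holomorphic_intros holomorphic_on_subset[OF hol])
    then show "(\<lambda>w. \<phi> w - z i) holomorphic_on ball w0 (s / 2)" "continuous_on (cball w0 (s / 2)) (\<lambda>w. \<phi> w - z i)"
      using holomorphic_on_subset ball_subset_cball holomorphic_on_imp_continuous_on by blast+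
    show "cmod (\<phi> x - z i) \<le> \<sigma> k" if "cmod (w0 - x) = s / 2" for x
    proof -
      have "x \<in> D" using that sub by (auto simp: dist_norm)
      then show ?thesis using close[OF \<phi> order_refl] by (simp add: dist_norm)
    qed
  qed (use s in simp)
  moreover have "deriv (\<lambda>w. \<phi> w - z i) w0 = deriv \<phi> w0"
    by (rule DERIV_imp_deriv) (auto intro!: derivative_eq_intros d\<phi>)
  ultimately have le: "cmod (deriv \<phi> w0) \<le> 2 * \<sigma> k / s" by (simp add: mult.commute)
  have "1 = cmod \<Lambda> * cmod (deriv \<phi> w0)" using prod by (metis norm_mult norm_one)
  also have "\<dots> \<le> cmod \<Lambda> * (2 * \<sigma> k / s)" using le by (intro mult_left_mono) auto
  finally show ?thesis
    unfolding \<Lambda>_def[symmetric] using s \<sigma>[of k] by (simp add: field_simps)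
qed

section \<open>Expansion along orbits asymptotic to the Julia set\<close>

lemma eventually_exp_decay_less:
  fixes K c e :: real
  assumes "0 < c" "0 < e"
  shows "\<forall>\<^sub>F n in sequentially. K * exp (- (c * real n)) < e"
proof -
  have "((\<lambda>x. K * exp (- (c * x))) \<longlongrightarrow> K * 0) at_top"
    by (intro tendsto_intros filterlim_compose[OF exp_at_bot]
        filterlim_compose[OF filterlim_uminus_at_bot_at_top]
        filterlim_tendsto_pos_mult_at_top[OF tendsto_const assms(1)] filterlim_ident)
  then have "((\<lambda>n. K * exp (- (c * real n))) \<longlongrightarrow> K * 0) sequentially"
    by (rule filterlim_compose[OF _ filterlim_real_sequentially])
  then show ?thesis using assms(2) by (intro order_tendstoD) auto
qed

text \<open>A number \<open>n\<close> is the end of a block that starts at \<open>i = n - k\<close> with \<open>k\<close> about \<open>\<tau> n / 2\<close>. The block loses \<open>\<delta> i\<close>,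
which the allowance \<open>\<delta>' / 2 * k\<close> for its length covers if \<open>\<delta> \<le> \<delta>' \<tau> / 8\<close>. The other half of \<open>\<delta>'\<close>
absorbs the finitely many values before the first block.\<close>

lemma sublinear_loss_by_geometric_blocks:
  fixes a :: "nat \<Rightarrow> real"
  assumes \<tau>: "0 < \<tau>" "\<tau> \<le> 1" and \<omega>: "0 < \<omega>"
    and block: "\<And>\<delta>. 0 < \<delta> \<Longrightarrow> \<delta> \<le> \<omega> \<Longrightarrow>
      \<exists>i0. \<forall>i\<ge>i0. \<forall>k. real k \<le> \<tau> * real i \<longrightarrow> a i - \<delta> * real i \<le> a (i + k)"
    and \<delta>': "0 < \<delta>'"
  shows "\<forall>\<^sub>F n in sequentially. - \<delta>' * real n \<le> a n"
proof -
  define \<delta> where "\<delta> = min \<omega> (\<delta>' * \<tau> / 8)"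
  have \<delta>: "0 < \<delta>" "\<delta> \<le> \<omega>" "\<delta> \<le> \<delta>' * \<tau> / 8" using \<tau> \<omega> \<delta>' by (auto simp: \<delta>_def)
  obtain i0 where i0: "\<And>i k. i \<ge> i0 \<Longrightarrow> real k \<le> \<tau> * real i \<Longrightarrow> a i - \<delta> * real i \<le> a (i + k)"
    using block[OF \<delta>(1,2)] by blast
  define n1 where "n1 = 2 * i0 + nat \<lceil>4 / \<tau>\<rceil>"
  define c where "c = (\<Sum>n<n1. \<bar>a n\<bar>)"
  have c0: "0 \<le> c" unfolding c_def by (intro sum_nonneg) auto
  have low: "- c - \<delta>' / 2 * real n \<le> a n" for n
  proof (induction n rule: less_induct)
    case (less n)
    show ?case
    proof (cases "n < n1")
      case True
      then have "\<bar>a n\<bar> \<le> c" unfolding c_def by (intro member_le_sum) auto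
      moreover have "0 \<le> \<delta>' / 2 * real n" using \<delta>' by simp
      ultimately show ?thesis by linarith
    next
      case False
      \<comment> \<open>Half of \<open>\<tau>\<close>, since the length is to be compared with \<open>i \<ge> n / 2\<close> and not with \<open>n\<close>.\<close>
      define k where "k = nat \<lfloor>\<tau> * real n / 2\<rfloor>"
      define i where "i = n - k"
      have "\<tau> * real n \<le> 1 * real n" using \<tau> by (intro mult_right_mono) auto
      then have tn: "0 \<le> \<tau> * real n / 2" "\<tau> * real n \<le> real n" using \<tau> by auto
      have k1: "real k \<le> \<tau> * real n / 2" "\<tau> * real n / 2 - 1 < real k"
        unfolding k_def using tn by linarith+
      have "4 / \<tau> \<le> real n" using False unfolding n1_def by linarith
      then have n4: "4 \<le> \<tau> * real n" using \<tau> by (simp add: field_simps)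
      then have k2: "\<tau> * real n / 4 \<le> real k" "0 < k" using k1 by (linarith, force)
      have "k \<le> n" using k1 tn by linarith
      then have n: "n = i + k" "real i = real n - real k" by (auto simp: i_def)
      have i: "real n / 2 \<le> real i" "i < n" using k1 tn k2 n by linarith+
      have "2 * i0 \<le> n" using False by (simp add: n1_def)
      then have "i0 \<le> i" using i by linarith
      moreover have "real k \<le> \<tau> * real i"
      proof -
        have "\<tau> * real n / 2 \<le> \<tau> * real i"
          using mult_left_mono[OF i(1), of \<tau>] \<tau> by (simp only: times_divide_eq_right)
        then show ?thesis using k1 by linarith
      qed
      ultimately have "a i - \<delta> * real i \<le> a n" unfolding n(1) by (rule i0)
      moreover have "\<delta> * real i \<le> \<delta>' / 2 * real k"
      proof -
        have "\<delta> * real i \<le> (\<delta>' * \<tau> / 8) * real n"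
          using \<delta> i \<tau> \<delta>' by (intro mult_mono) auto
        also have "\<dots> = \<delta>' / 2 * (\<tau> * real n / 4)" by simp
        also have "\<dots> \<le> \<delta>' / 2 * real k" using k2 \<delta>' by (intro mult_left_mono) auto
        finally show ?thesis .
      qed
      moreover have "\<delta>' / 2 * real n = \<delta>' / 2 * real i + \<delta>' / 2 * real k"
        unfolding n(1) by (simp add: algebra_simps)
      ultimately show ?thesis using less.IH[OF i(2)] by linarith
    qed
  qed
  have "- \<delta>' * real n \<le> a n" if "n \<ge> nat \<lceil>2 * c / \<delta>'\<rceil>" for n
  proof -
    have "2 * c / \<delta>' \<le> real n" using that by linarith
    then have "c \<le> \<delta>' / 2 * real n" using \<delta>' by (simp add: field_simps)
    then show ?thesis using low[of n] by linarith
  qed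
  then show ?thesis unfolding eventually_sequentially by blast
qed

text \<open>A nonautonomous orbit that converges to \<open>J\<close>, under maps that converge exponentially fast to \<open>p\<close>. The
rate \<open>\<theta>\<close> will be \<open>|\<lambda>|\<close>, and \<open>slow\<close> is what slow approach to the critical set means for the
derivatives.\<close>

locale asymptotic_orbit = escaping_entire p R for p R +
  fixes H :: "nat \<Rightarrow> complex \<Rightarrow> complex" and z :: "nat \<Rightarrow> complex" and M A \<theta> B \<mu> \<rho> C :: real
  assumes holo_H: "\<And>n. H n holomorphic_on UNIV" and orbit: "\<And>n. z (Suc n) = H n (z n)"
    and z_bound: "\<And>n. cmod (z n) \<le> R" and z_to_J: "(\<lambda>n. infdist (z n) J) \<longlonglongrightarrow> 0"
    and lip: "\<And>u v. cmod u \<le> R + 2 \<Longrightarrow> cmod v \<le> R + 2 \<Longrightarrow> dist (p u) (p v) \<le> M * dist u v"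
    and M: "2 \<le> M"
    and near_p: "\<And>n u. cmod u \<le> R + 1 \<Longrightarrow> dist (p u) (H n u) \<le> A * \<theta> ^ n"
    and A: "0 \<le> A" and \<theta>: "0 < \<theta>" "\<theta> < 1"
    and deriv_lip: "\<And>n u. u \<in> ball (z n) 1 \<Longrightarrow>
        cmod (deriv (H n) u - deriv (H n) (z n)) \<le> B * dist u (z n)" and B: "1 \<le> B"
    and shr: "backward_shrinking \<mu> \<rho> C" and \<mu>: "1 < \<mu>" and \<rho>: "0 < \<rho>" and C: "0 < C"
    and slow: "\<And>\<alpha>. 0 < \<alpha> \<Longrightarrow>
        \<forall>\<^sub>F n in sequentially. exp (- (\<alpha> * real n)) \<le> cmod (deriv (H n) (z n))"
begin

text \<open>The set \<open>S\<close> is a pull-back of a disk by \<open>m\<close> maps \<open>H\<close>. Its image under \<open>p^m\<close> is close to that disk,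
whose radius \<open>s\<close> dominates the accumulated error, and the disk follows the orbit \<open>z\<close> towards \<open>J\<close> for
\<open>q\<close> further iterates. So \<open>p^(m + q)\<close> maps \<open>S\<close> near a point of \<open>J\<close>. Shadowing is applied
separately before and after the time \<open>j + m\<close>: in a single application the error \<open>s\<close> at that time would
be multiplied by \<open>M^(m + q)\<close>, and not just by \<open>M^q\<close>.\<close>

lemma diameter_of_pullback:
  assumes i: "i \<le> j" and \<epsilon>: "A * \<theta> ^ i \<le> \<epsilon>" and k: "m \<le> k"
    and s1: "M ^ k * (2 * \<epsilon>) \<le> s" "s \<le> 1" "\<epsilon> \<le> 2 * s"
    and s2: "M ^ q * (4 * s) \<le> 1" "M ^ q * (4 * s) < \<rho> / 2"
    and close: "infdist (z (j + m + q)) J < \<rho> / 2"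
    and S: "connected S" "z j \<in> S"
      "\<And>u l. u \<in> S \<Longrightarrow> l \<le> m \<Longrightarrow> cmod (iter_from H j l u) \<le> R + 1"
      "iter_from H j m ` S \<subseteq> ball (z (j + m)) s"
    and u: "u \<in> S"
  shows "dist u (z j) \<le> C / \<mu> ^ (m + q)"
proof -
  have \<epsilon>0: "0 \<le> \<epsilon>" using \<epsilon> A \<theta> by (smt (verit) mult_nonneg_nonneg zero_le_power)
  have err: "dist (p w) (H (j + l) w) \<le> \<epsilon>" if "cmod w \<le> R + 1" for w l
  proof -
    have "\<theta> ^ (j + l) \<le> \<theta> ^ i" using i \<theta> by (intro power_decreasing) auto
    then have "A * \<theta> ^ (j + l) \<le> A * \<theta> ^ i" using A by (intro mult_left_mono)
    then show ?thesis using near_p[OF that, of "j + l"] \<epsilon> by linarith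
  qed
  have Mm: "M ^ m * (2 * \<epsilon>) \<le> s"
  proof -
    have "M ^ m * (2 * \<epsilon>) \<le> M ^ k * (2 * \<epsilon>)"
      using k M \<epsilon>0 by (intro mult_right_mono power_increasing) auto
    then show ?thesis using s1 by linarith
  qed
  obtain y where y: "y \<in> J" "infdist (z (j + m + q)) J = dist (z (j + m + q)) y"
    using infdist_attains_inf[OF closed_J J_nonempty] by blast
  have "(p ^^ (m + q)) w \<in> ball y \<rho>" if w: "w \<in> S" for w
  proof -
    have "dist ((p ^^ m) w) (iter_from H j m w) \<le> M ^ m * (2 * \<epsilon>)"
      by (rule pseudo_orbit_shadowing[where B = "R + 1" and N = m])
        (use lip M err S(3)[OF w] Mm s1 \<epsilon>0 in \<open>auto simp: add.assoc\<close>)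
    moreover have "dist (iter_from H j m w) (z (j + m)) < s" using S(4) w by (auto simp: dist_commute)
    ultimately have start: "dist ((p ^^ m) w) (z (j + m)) \<le> 2 * s"
      using Mm dist_triangle[of "(p ^^ m) w" "z (j + m)" "iter_from H j m w"] by linarith
    have "dist ((p ^^ q) ((p ^^ m) w)) (z (j + m + q)) \<le> M ^ q * (2 * (2 * s))"
    proof (rule pseudo_orbit_shadowing[where B = "R + 1" and N = q and u = "\<lambda>l. z (j + m + l)"])
      fix l
      have "dist (p (z (j + m + l))) (H (j + (m + l)) (z (j + m + l))) \<le> \<epsilon>"
        using z_bound[of "j + m + l"] by (intro err) auto
      then show "dist (p (z (j + m + l))) (z (j + m + Suc l)) \<le> 2 * s"
        using orbit[of "j + m + l"] s1 by (simp add: add.assoc)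
      show "cmod (z (j + m + l)) \<le> R + 1" using z_bound[of "j + m + l"] by simp
    qed (use lip M start s2 in \<open>auto simp: add.assoc\<close>)
    then have "dist ((p ^^ q) ((p ^^ m) w)) (z (j + m + q)) < \<rho> / 2" using s2 by simp
    then have "dist y ((p ^^ q) ((p ^^ m) w)) < \<rho>"
      using y close dist_triangle[of "(p ^^ q) ((p ^^ m) w)" y "z (j + m + q)"]
      by (simp add: dist_commute)
    then show ?thesis by (simp add: funpow_add add.commute[of m q])
  qed
  then show ?thesis
    using shr S(1,2) u y(1) unfolding backward_shrinking_def by blast
qed

text \<open>With \<open>s = exp (-\<delta> i)\<close>, the bound on \<open>k\<close> gives \<open>M^k \<le> exp (L i / 4)\<close>, so the error
\<open>M^k \<theta>^i\<close> is dominated by \<open>s\<close>. The number \<open>q\<close> of further iterates is \<open>\<eta> i\<close>, where \<open>\<eta>\<close> is such that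
\<open>M^q \<le> exp (\<delta> i / 2)\<close>. Finally \<open>\<alpha>\<close> is such that the radius \<open>\<kappa>^2 / (12 B)\<close> of the inverse
branches, with \<open>\<kappa> = exp (-2 \<alpha> i)\<close>, decays like \<open>\<mu>^(-q/2)\<close>, and so exceeds the diameters \<open>C / \<mu>^q\<close>
of the pull-backs for large \<open>i\<close>. The factor 2 in \<open>\<kappa>\<close> comes from \<open>i + k \<le> 2 i\<close>.\<close>

lemma block_expansion:
  defines "L \<equiv> - ln \<theta>"
  assumes \<delta>: "0 < \<delta>" "\<delta> \<le> L / 2"
  shows "\<exists>i0. \<forall>i\<ge>i0. \<forall>k. real k \<le> min 1 (L / (4 * ln M)) * real i \<longrightarrow>
    exp (- (\<delta> * real i)) * \<mu> ^ k \<le> cmod (\<Prod>l<k. deriv (H (i + l)) (z (i + l)))"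
proof -
  have L: "0 < L" using \<theta> by (simp add: L_def)
  have lnM: "0 < ln M" using M by simp
  have ln\<mu>: "0 < ln \<mu>" using \<mu> by simp
  define \<eta> where "\<eta> = \<delta> / (2 * ln M)"
  have \<eta>: "0 < \<eta>" using \<delta> lnM by (simp add: \<eta>_def)
  define \<alpha> where "\<alpha> = \<eta> * ln \<mu> / 8"
  have \<alpha>: "0 < \<alpha>" using \<eta> ln\<mu> by (simp add: \<alpha>_def)
  have L4: "0 < L / 4" using L by simp
  have "\<forall>\<^sub>F i in sequentially. (2 * A) * exp (- (L / 4 * real i)) < 1"
    using L4 by (intro eventually_exp_decay_less) auto
  moreover have "\<forall>\<^sub>F i in sequentially. 4 * exp (- (\<delta> / 2 * real i)) < min 1 (\<rho> / 2)"
    using \<delta> \<rho> by (intro eventually_exp_decay_less) auto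
  moreover have "\<forall>\<^sub>F i in sequentially. (2 * C * \<mu>) * exp (- (\<eta> * ln \<mu> * real i)) < 1"
    using \<eta> ln\<mu> by (intro eventually_exp_decay_less) auto
  moreover have "\<forall>\<^sub>F i in sequentially. (12 * B * C * \<mu>) * exp (- (\<eta> * ln \<mu> / 2 * real i)) < 1"
    using \<eta> ln\<mu> by (intro eventually_exp_decay_less) auto
  moreover have "\<forall>\<^sub>F i in sequentially. infdist (z i) J < \<rho> / 2"
    using z_to_J \<rho> by (intro order_tendstoD) auto
  moreover note slow[OF \<alpha>]
  ultimately have "\<forall>\<^sub>F i in sequentially. (2 * A) * exp (- (L / 4 * real i)) < 1 \<and>
      4 * exp (- (\<delta> / 2 * real i)) < min 1 (\<rho> / 2) \<and>
      (2 * C * \<mu>) * exp (- (\<eta> * ln \<mu> * real i)) < 1 \<and>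
      (12 * B * C * \<mu>) * exp (- (\<eta> * ln \<mu> / 2 * real i)) < 1 \<and>
      infdist (z i) J < \<rho> / 2 \<and> exp (- (\<alpha> * real i)) \<le> cmod (deriv (H i) (z i))"
    by eventually_elim auto
  then obtain i0 where i0: "\<And>i. i \<ge> i0 \<Longrightarrow> (2 * A) * exp (- (L / 4 * real i)) < 1"
      "\<And>i. i \<ge> i0 \<Longrightarrow> 4 * exp (- (\<delta> / 2 * real i)) < min 1 (\<rho> / 2)"
      "\<And>i. i \<ge> i0 \<Longrightarrow> (2 * C * \<mu>) * exp (- (\<eta> * ln \<mu> * real i)) < 1"
      "\<And>i. i \<ge> i0 \<Longrightarrow> (12 * B * C * \<mu>) * exp (- (\<eta> * ln \<mu> / 2 * real i)) < 1"
      "\<And>i. i \<ge> i0 \<Longrightarrow> infdist (z i) J < \<rho> / 2"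
      "\<And>i. i \<ge> i0 \<Longrightarrow> exp (- (\<alpha> * real i)) \<le> cmod (deriv (H i) (z i))"
    unfolding eventually_sequentially by blast
  have "exp (- (\<delta> * real i)) * \<mu> ^ k \<le> cmod (\<Prod>l<k. deriv (H (i + l)) (z (i + l)))"
    if i: "i \<ge> i0" and k: "real k \<le> min 1 (L / (4 * ln M)) * real i" for i k
  proof -
    define s where "s = exp (- (\<delta> * real i))"
    define \<epsilon> where "\<epsilon> = A * \<theta> ^ i"
    define q where "q = nat \<lfloor>\<eta> * real i\<rfloor>"
    define \<kappa> where "\<kappa> = exp (- (2 * \<alpha> * real i))"
    define \<sigma> where "\<sigma> m = C / \<mu> ^ (m + q)" for m
    have \<delta>i: "0 \<le> \<delta> * real i" "0 \<le> \<eta> * real i" using \<delta> \<eta> by auto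
    have pow_exp: "x ^ n = exp (real n * ln x)" if "0 < x" for x :: real and n
      using that by (simp add: exp_of_nat_mult)
    have q: "real q \<le> \<eta> * real i" "\<eta> * real i - 1 \<le> real q"
      unfolding q_def using \<delta>i by linarith+
    have "min 1 (L / (4 * ln M)) * real i \<le> 1 * real i"
      by (intro mult_right_mono) auto
    then have ki: "k \<le> i" using k by linarith
    have "min 1 (L / (4 * ln M)) * real i \<le> L / (4 * ln M) * real i"
      by (intro mult_right_mono) auto
    then have "real k \<le> L / (4 * ln M) * real i" using k by linarith
    then have "real k * ln M \<le> L / (4 * ln M) * real i * ln M" using lnM by (intro mult_right_mono) auto
    also have "\<dots> = L / 4 * real i" using lnM by (simp add: field_simps)
    finally have Mk: "M ^ k \<le> exp (L / 4 * real i)" using M by (simp add: pow_exp)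
    have "real q * ln M \<le> \<eta> * real i * ln M" using q lnM by (intro mult_right_mono) auto
    also have "\<dots> = \<delta> / 2 * real i" using lnM by (simp add: \<eta>_def field_simps)
    finally have Mq: "M ^ q \<le> exp (\<delta> / 2 * real i)" using M by (simp add: pow_exp)
    have \<epsilon>: "\<epsilon> = A * exp (- (L * real i))" unfolding \<epsilon>_def L_def using \<theta> by (simp add: pow_exp mult.commute)
    have s: "0 < s" "s \<le> 1" using \<delta>i by (auto simp: s_def)
    have \<epsilon>0: "0 \<le> \<epsilon>" using A by (simp add: \<epsilon>)
    have a1: "M ^ k * (2 * \<epsilon>) \<le> s"
    proof -
      have "M ^ k * (2 * \<epsilon>) \<le> exp (L / 4 * real i) * (2 * \<epsilon>)"
        using Mk \<epsilon>0 by (intro mult_right_mono) auto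
      also have "\<dots> = ((2 * A) * exp (- (L / 4 * real i))) * exp (- (L / 2 * real i))"
        unfolding \<epsilon> by (simp add: mult.assoc flip: exp_add)
      also have "\<dots> \<le> 1 * exp (- (L / 2 * real i))"
        using i0(1)[OF i] by (intro mult_right_mono) auto
      also have "\<dots> \<le> s" unfolding s_def using mult_right_mono[OF \<delta>(2), of "real i"] by simp
      finally show ?thesis .
    qed
    have a2: "\<epsilon> \<le> 2 * s"
    proof -
      have "1 * (2 * \<epsilon>) \<le> M ^ k * (2 * \<epsilon>)" using M \<epsilon>0 by (intro mult_right_mono) (auto intro: one_le_power)
      then show ?thesis using a1 s \<epsilon>0 by linarith
    qed
    have "M ^ q * (4 * s) \<le> exp (\<delta> / 2 * real i) * (4 * s)"
      using Mq s by (intro mult_right_mono) auto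
    also have "\<dots> = 4 * exp (- (\<delta> / 2 * real i))"
      unfolding s_def by (simp flip: exp_add)
    finally have a3: "M ^ q * (4 * s) \<le> 1" "M ^ q * (4 * s) < \<rho> / 2" using i0(2)[OF i] by auto
    have "(\<eta> * real i - 1) * ln \<mu> \<le> real q * ln \<mu>" using q ln\<mu> by (intro mult_right_mono) auto
    then have "exp (\<eta> * ln \<mu> * real i - ln \<mu>) \<le> \<mu> ^ q"
      using \<mu> by (simp add: pow_exp algebra_simps)
    then have \<mu>q: "exp (\<eta> * ln \<mu> * real i) \<le> \<mu> * \<mu> ^ q"
      using \<mu> by (simp add: exp_diff field_simps)
    \<comment> \<open>The surplus \<open>\<mu>^q\<close> absorbs the constants in the derivative bound.\<close>
    have b: "2 * C \<le> \<mu> ^ q"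
    proof -
      have "2 * C * \<mu> < exp (\<eta> * ln \<mu> * real i)" using i0(3)[OF i] by (simp add: exp_minus field_simps)
      then have "\<mu> * (2 * C) \<le> \<mu> * \<mu> ^ q" using \<mu>q by (simp add: mult_ac)
      then show ?thesis using \<mu> by simp
    qed
    have \<sigma>_le: "\<sigma> m \<le> C / \<mu> ^ q" for m
      unfolding \<sigma>_def using \<mu> C by (intro divide_left_mono power_increasing mult_pos_pos) auto
    have c: "C / \<mu> ^ q < \<kappa>\<^sup>2 / (12 * B)"
    proof -
      have k2: "\<kappa>\<^sup>2 = exp (- (\<eta> * ln \<mu> / 2 * real i))"
        unfolding \<kappa>_def \<alpha>_def power2_eq_square by (simp flip: exp_add)
      have e2: "exp (\<eta> * ln \<mu> * real i) * \<kappa>\<^sup>2 = exp (\<eta> * ln \<mu> / 2 * real i)"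
        unfolding k2 by (simp flip: exp_add)
      have "12 * B * C * \<mu> < exp (\<eta> * ln \<mu> / 2 * real i)"
        using i0(4)[OF i] by (simp add: exp_minus field_simps)
      also have "\<dots> \<le> (\<mu> * \<mu> ^ q) * \<kappa>\<^sup>2" unfolding e2[symmetric] using \<mu>q by (intro mult_right_mono) auto
      finally have "\<mu> * (12 * B * C) < \<mu> * (\<mu> ^ q * \<kappa>\<^sup>2)" by (simp add: mult_ac)
      then have "12 * B * C < \<mu> ^ q * \<kappa>\<^sup>2" using \<mu> by simp
      then show ?thesis using \<mu> B by (simp add: field_simps)
    qed
    have \<kappa>: "0 < \<kappa>" "\<kappa> \<le> B"
    proof -
      have "0 \<le> 2 * \<alpha> * real i" using \<alpha> by simp
      then have "\<kappa> \<le> 1" by (simp add: \<kappa>_def)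
      then show "\<kappa> \<le> B" using B by linarith
      show "0 < \<kappa>" by (simp add: \<kappa>_def)
    qed
    have "s / (2 * \<sigma> k) \<le> cmod (\<Prod>l<k. deriv (H (i + l)) (z (i + l)))"
    proof (rule derivative_lower_bound_from_inverse_branch[where R' = "R + 1" and H = H and z = z and B = B and \<kappa> = \<kappa>, OF holo_H orbit \<kappa>])
      fix j assume j: "i \<le> j" "j < i + k"
      have "\<alpha> * real j \<le> \<alpha> * (2 * real i)" using \<alpha> j ki by (intro mult_left_mono) auto
      then have "\<kappa> \<le> exp (- (\<alpha> * real j))" by (simp add: \<kappa>_def)
      also have "\<dots> \<le> cmod (deriv (H j) (z j))" using i0(6)[of j] i j by simp
      finally show "\<kappa> \<le> cmod (deriv (H j) (z j))" .
    next
      fix m S u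
      assume m: "m \<le> k" and S: "connected S" "z (i + k - m) \<in> S"
        "\<And>u l. u \<in> S \<Longrightarrow> l \<le> m \<Longrightarrow> cmod (iter_from H (i + k - m) l u) \<le> R + 1"
        "iter_from H (i + k - m) m ` S \<subseteq> ball (z (i + k)) s" and u: "u \<in> S"
      show "dist u (z (i + k - m)) \<le> \<sigma> m"
        unfolding \<sigma>_def
        by (rule diameter_of_pullback[where i = i and k = k and s = s and \<epsilon> = \<epsilon> and S = S])
          (use m S u a1 a2 a3 s i i0(5)[of "i + k + q"] in \<open>auto simp: \<epsilon>_def\<close>)
    next
      fix m assume "m \<le> k"
      show "0 < \<sigma> m \<and> \<sigma> m < \<kappa>\<^sup>2 / (12 * B)"
        using \<sigma>_le[of m] c C \<mu> by (auto simp: \<sigma>_def)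
    qed (use deriv_lip s z_bound in auto)
    moreover have "exp (- (\<delta> * real i)) * \<mu> ^ k \<le> s / (2 * \<sigma> k)"
    proof -
      have "2 * \<sigma> k = 2 * C / (\<mu> ^ k * \<mu> ^ q)" by (simp add: \<sigma>_def power_add)
      then have "s / (2 * \<sigma> k) = s * \<mu> ^ k * (\<mu> ^ q / (2 * C))" using C by simp
      moreover have "1 \<le> \<mu> ^ q / (2 * C)" using b C by simp
      ultimately show ?thesis
        using mult_left_mono[of 1 "\<mu> ^ q / (2 * C)" "s * \<mu> ^ k"] s \<mu> by (simp add: s_def)
    qed
    ultimately show ?thesis by linarith
  qed
  then show ?thesis by blast
qed

lemma derivative_growth:
  assumes nz: "\<And>n. deriv (H n) (z n) \<noteq> 0" and \<delta>: "0 < \<delta>"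
  shows "\<forall>\<^sub>F n in sequentially. (ln \<mu> - \<delta>) * real n \<le> ln (cmod (\<Prod>l<n. deriv (H l) (z l)))"
proof -
  define D where "D n = cmod (\<Prod>l<n. deriv (H l) (z l))" for n
  define L where "L = - ln \<theta>"
  have L: "0 < L" using \<theta> by (simp add: L_def)
  have lnM: "0 < ln M" using M by simp
  have D0: "0 < D n" for n unfolding D_def using nz by (simp add: prod_zero_iff)
  have D_add: "D (i + k) = D i * cmod (\<Prod>l<k. deriv (H (i + l)) (z (i + l)))" for i k
  proof -
    have "(\<Prod>l<i + k. deriv (H l) (z l)) =
        (\<Prod>l<i. deriv (H l) (z l)) * (\<Prod>l<k. deriv (H (i + l)) (z (i + l)))"
      by (induction k) (auto simp: mult.assoc)
    then show ?thesis by (simp add: D_def norm_mult)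
  qed
  have "\<forall>\<^sub>F n in sequentially. - \<delta> * real n \<le> ln (D n) - real n * ln \<mu>"
  proof (rule sublinear_loss_by_geometric_blocks[where \<tau> = "min 1 (L / (4 * ln M))" and \<omega> = "L / 2"])
    fix \<delta>1 :: real assume \<delta>1: "0 < \<delta>1" "\<delta>1 \<le> L / 2"
    obtain i0 where i0: "\<And>i k. i \<ge> i0 \<Longrightarrow> real k \<le> min 1 (L / (4 * ln M)) * real i \<Longrightarrow>
       exp (- (\<delta>1 * real i)) * \<mu> ^ k \<le> cmod (\<Prod>l<k. deriv (H (i + l)) (z (i + l)))"
      using block_expansion[of \<delta>1] \<delta>1 unfolding L_def by blast
    have "ln (D i) - real i * ln \<mu> - \<delta>1 * real i \<le> ln (D (i + k)) - real (i + k) * ln \<mu>"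
      if "i \<ge> i0" "real k \<le> min 1 (L / (4 * ln M)) * real i" for i k
    proof -
      define x where "x = cmod (\<Prod>l<k. deriv (H (i + l)) (z (i + l)))"
      have "exp (- (\<delta>1 * real i)) * \<mu> ^ k \<le> x" unfolding x_def using i0 that by blast
      moreover have "0 < exp (- (\<delta>1 * real i)) * \<mu> ^ k" using \<mu> by simp
      ultimately have "ln (exp (- (\<delta>1 * real i)) * \<mu> ^ k) \<le> ln x" "0 < x" by auto
      moreover have "ln (exp (- (\<delta>1 * real i)) * \<mu> ^ k) = - (\<delta>1 * real i) + real k * ln \<mu>"
        using \<mu> by (simp add: ln_mult ln_realpow)
      moreover have "ln (D (i + k)) = ln (D i) + ln x"
        using D0[of i] \<open>0 < x\<close> unfolding D_add x_def[symmetric] by (simp add: ln_mult)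
      ultimately show ?thesis by (simp add: algebra_simps)
    qed
    then show "\<exists>i0. \<forall>i\<ge>i0. \<forall>k. real k \<le> min 1 (L / (4 * ln M)) * real i \<longrightarrow>
        ln (D i) - real i * ln \<mu> - \<delta>1 * real i \<le> ln (D (i + k)) - real (i + k) * ln \<mu>"
      by blast
  qed (use L lnM \<delta> in auto)
  then show ?thesis unfolding D_def by eventually_elim (simp add: algebra_simps)
qed

end

section \<open>Estimates for polynomials\<close>

lemma poly_eq_sum_coeffs:
  fixes q :: "'a::comm_semiring_1 poly"
  assumes "degree q \<le> n"
  shows "poly q z = (\<Sum>i\<le>n. coeff q i * z ^ i)"
proof -
  have "(\<Sum>i\<le>degree q. coeff q i * z ^ i) = (\<Sum>i\<le>n. coeff q i * z ^ i)"
    using assms by (intro sum.mono_neutral_left) (auto simp: coeff_eq_0)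
  then show ?thesis by (simp add: poly_altdef)
qed

lemma norm_poly_le:
  fixes q :: "complex poly"
  assumes "degree q \<le> n" "\<And>i. i \<le> n \<Longrightarrow> cmod (coeff q i) \<le> A" "cmod u \<le> X" "1 \<le> X"
  shows "cmod (poly q u) \<le> real (Suc n) * A * X ^ n"
proof -
  have A: "0 \<le> A" using assms(2)[of 0] norm_ge_zero[of "coeff q 0"] by linarith
  have "cmod (coeff q i * u ^ i) \<le> A * X ^ n" if "i \<le> n" for i
  proof -
    have "cmod u ^ i \<le> X ^ i" using assms by (intro power_mono) auto
    also have "\<dots> \<le> X ^ n" using assms that by (intro power_increasing) auto
    finally show ?thesis
      unfolding norm_mult norm_power using assms(2)[OF that] A by (intro mult_mono) auto
  qed
  then have "cmod (poly q u) \<le> (\<Sum>i\<le>n. A * X ^ n)"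
    unfolding poly_eq_sum_coeffs[OF assms(1)] by (intro sum_norm_le) auto
  then show ?thesis by simp
qed

lemma norm_poly_ge_near_infinity:
  fixes q :: "complex poly"
  assumes "degree q \<le> Suc n" "\<And>i. i \<le> n \<Longrightarrow> cmod (coeff q i) \<le> A"
    and b: "b \<le> cmod (coeff q (Suc n))" and z: "1 \<le> cmod z" "real (Suc n) * A + c \<le> b * cmod z"
  shows "c * cmod z ^ n \<le> cmod (poly q z)"
proof -
  have A: "0 \<le> A" using assms(2)[of 0] norm_ge_zero[of "coeff q 0"] by linarith
  have "cmod (coeff q i * z ^ i) \<le> A * cmod z ^ n" if "i \<le> n" for i
    unfolding norm_mult norm_power
    using assms(2)[OF that] A z that by (intro mult_mono power_increasing) auto
  then have "cmod (\<Sum>i\<le>n. coeff q i * z ^ i) \<le> (\<Sum>i\<le>n. A * cmod z ^ n)"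
    by (intro sum_norm_le) auto
  then have low: "cmod (\<Sum>i\<le>n. coeff q i * z ^ i) \<le> real (Suc n) * A * cmod z ^ n" by simp
  have "c * cmod z ^ n \<le> (b * cmod z - real (Suc n) * A) * cmod z ^ n"
    using z by (intro mult_right_mono) auto
  also have "\<dots> = b * cmod z ^ Suc n - real (Suc n) * A * cmod z ^ n" by (simp add: algebra_simps)
  also have "\<dots> \<le> cmod (coeff q (Suc n) * z ^ Suc n) - cmod (\<Sum>i\<le>n. coeff q i * z ^ i)"
    unfolding norm_mult norm_power using low b by (intro diff_mono mult_right_mono) auto
  also have "\<dots> \<le> cmod (coeff q (Suc n) * z ^ Suc n + (\<Sum>i\<le>n. coeff q i * z ^ i))"
    using norm_diff_ineq by blast
  also have "\<dots> = cmod (poly q z)"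
    unfolding poly_eq_sum_coeffs[OF assms(1)] by (simp add: add.commute)
  finally show ?thesis .
qed

text \<open>Applied to the derivative of a fibre polynomial, this turns a bound for the distance to the critical
points into one for the derivative.\<close>

lemma norm_poly_ge_dist_roots:
  fixes q :: "complex poly"
  assumes "q \<noteq> 0" "0 \<le> e" "\<And>x. poly q x = 0 \<Longrightarrow> e \<le> dist z x"
  shows "cmod (lead_coeff q) * e ^ degree q \<le> cmod (poly q z)"
proof -
  obtain S where S: "size S = degree q" "q = smult (lead_coeff q) (\<Prod>x\<in>#S. [:-x, 1:])"
    using alg_closed_imp_factorization[OF assms(1)] by blast
  have ev: "poly (smult k (\<Prod>x\<in>#T. [:-x, 1:])) w = k * (\<Prod>x\<in>#T. w - x)" for k w and T :: "complex multiset"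
    by (induction T) (auto simp: algebra_simps)
  have "e \<le> cmod (z - x)" if "x \<in># S" for x
  proof -
    have "(\<Prod>y\<in>#S. x - y) = 0" using that by auto
    then have "poly q x = 0" by (subst S(2)) (simp only: ev mult_zero_right)
    then show ?thesis using assms(3) by (simp add: dist_norm)
  qed
  then have "e ^ size S \<le> cmod (\<Prod>x\<in>#S. z - x)"
    using assms(2) by (induction S) (auto simp: norm_mult intro!: mult_mono)
  then have "cmod (lead_coeff q) * e ^ size S \<le> cmod (lead_coeff q) * cmod (\<Prod>x\<in>#S. z - x)"
    by (intro mult_left_mono) auto
  also have "\<dots> = cmod (poly q z)" by (subst (2) S(2)) (simp only: ev norm_mult)
  finally show ?thesis by (simp add: S(1))
qed

lemma coeff_pderiv_norm_le:
  fixes q :: "complex poly"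
  assumes "degree q \<le> Suc n" "\<And>i. i \<le> Suc n \<Longrightarrow> cmod (coeff q i) \<le> A" "i \<le> n"
  shows "cmod (coeff (pderiv q) i) \<le> real (Suc n) * A"
  unfolding coeff_pderiv norm_mult using assms(2)[of "Suc i"] assms(3)
  by (intro mult_mono) (auto simp del: of_nat_Suc)

lemma poly_lipschitz_on_cball:
  fixes q :: "complex poly"
  assumes "degree q \<le> Suc n" "\<And>i. i \<le> Suc n \<Longrightarrow> cmod (coeff q i) \<le> A" "1 \<le> X"
    "cmod u \<le> X" "cmod v \<le> X"
  shows "dist (poly q u) (poly q v) \<le> real (Suc n) * (real (Suc n) * A) * X ^ n * dist u v"
  unfolding dist_norm
proof (rule field_differentiable_bound[where S = "cball 0 X" and f' = "poly (pderiv q)"])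
  fix z :: complex assume z: "z \<in> cball 0 X"
  show "(poly q has_field_derivative poly (pderiv q) z) (at z within cball 0 X)"
    by (rule DERIV_subset[OF poly_DERIV]) auto
  show "cmod (poly (pderiv q) z) \<le> real (Suc n) * (real (Suc n) * A) * X ^ n"
    using z assms by (intro norm_poly_le coeff_pderiv_norm_le) (auto simp: degree_pderiv)
qed (use assms in auto)

section \<open>The family of fibre polynomials\<close>

definition fibre_poly :: "nat \<Rightarrow> (nat \<Rightarrow> complex \<Rightarrow> complex) \<Rightarrow> complex \<Rightarrow> complex poly" where
  "fibre_poly d a t = (\<Sum>i\<le>d. monom (a i t) i)"

lemma coeff_fibre_poly: "coeff (fibre_poly d a t) i = (if i \<le> d then a i t else 0)"
  by (auto simp: fibre_poly_def coeff_sum coeff_monom)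

lemma degree_fibre_poly_le: "degree (fibre_poly d a t) \<le> d"
  by (rule degree_le) (simp add: coeff_fibre_poly)

lemma fibre_map_skew_product: "fibre_map (skew_product l d a) t = poly (fibre_poly d a t)"
  by (auto simp: fibre_map_def skew_product_def fibre_poly_def poly_sum poly_monom)

lemma deriv_poly: "deriv (poly q) = poly (pderiv q)" for q :: "complex poly"
  by (rule ext) (intro DERIV_imp_deriv poly_DERIV)

lemma skew_product_eq: "skew_product l d a (t, z) = (l * t, poly (fibre_poly d a t) z)"
  by (simp add: skew_product_def fibre_poly_def poly_sum poly_monom)

text \<open>Total differentiability needs the derivatives of the coefficients, but they do not enter the derivative
in the vertical direction.\<close>

lemma skew_product_has_derivative:
  assumes "\<And>i. i \<le> d \<Longrightarrow> (a i has_field_derivative a' i) (at t)"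
  shows "\<exists>F. (skew_product l d a has_derivative F) (at (t, z)) \<and>
    (\<forall>w. F (0, w) = (0, poly (pderiv (fibre_poly d a t)) z * w))"
proof -
  define G where "G i x = a i t * (of_nat i * (snd x * z ^ (i - 1))) + a' i * fst x * z ^ i"
    for i and x :: "complex \<times> complex"
  define F where "F x = (l * fst x, \<Sum>i\<le>d. G i x)" for x :: "complex \<times> complex"
  have summand: "((\<lambda>x. a i (fst x) * snd x ^ i) has_derivative G i) (at (t, z))" if "i \<le> d" for i
  proof -
    have "((\<lambda>x. a i (fst x)) has_derivative (\<lambda>x. a' i * fst x)) (at (t, z))"
      using has_derivative_compose[of fst fst "(t, z)" UNIV "a i" "(*) (a' i)"]
        assms[OF that] has_derivative_fst[OF has_derivative_ident, of "at (t, z)"]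
      by (simp add: has_field_derivative_def)
    then show ?thesis
      unfolding G_def by (auto intro!: derivative_eq_intros)
  qed
  have "skew_product l d a = (\<lambda>x. (l * fst x, \<Sum>i\<le>d. a i (fst x) * snd x ^ i))"
    by (auto simp: skew_product_def)
  moreover have "((\<lambda>x. (l * fst x, \<Sum>i\<le>d. a i (fst x) * snd x ^ i)) has_derivative F) (at (t, z))"
    unfolding F_def by (auto intro!: has_derivative_Pair has_derivative_sum summand derivative_eq_intros)
  ultimately have "(skew_product l d a has_derivative F) (at (t, z))" by simp
  moreover have "F (0, w) = (0, poly (pderiv (fibre_poly d a t)) z * w)" for w
  proof -
    have "((\<lambda>z. \<Sum>i\<le>d. a i t * z ^ i) has_field_derivative (\<Sum>i\<le>d. a i t * (of_nat i * z ^ (i - 1)))) (at z)"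
      by (auto intro!: derivative_eq_intros simp: mult_ac)
    moreover have "(\<lambda>z. \<Sum>i\<le>d. a i t * z ^ i) = poly (fibre_poly d a t)"
      by (auto simp: fibre_poly_def poly_sum poly_monom)
    ultimately have "poly (pderiv (fibre_poly d a t)) z = (\<Sum>i\<le>d. a i t * (of_nat i * z ^ (i - 1)))"
      using poly_DERIV DERIV_unique by metis
    then show ?thesis by (simp add: F_def G_def sum_distrib_left sum_distrib_right mult_ac)
  qed
  ultimately show ?thesis by blast
qed

text \<open>The linear bound in \<open>t\<close> is what makes the fibre polynomials along an orbit converge exponentially fast
to \<open>p\<close>.\<close>

lemma coefficients_near_zero:
  fixes a :: "nat \<Rightarrow> complex \<Rightarrow> complex"
  assumes "\<And>i. i \<le> d \<Longrightarrow> a i analytic_on {0}" "a d 0 \<noteq> 0"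
  obtains r K where "0 < r" "r \<le> 1" "0 < K"
    "\<And>i. i \<le> d \<Longrightarrow> a i holomorphic_on ball 0 r"
    "\<And>i t. i \<le> d \<Longrightarrow> t \<in> ball 0 r \<Longrightarrow> cmod (a i t - a i 0) \<le> K * cmod t"
    "\<And>t. t \<in> ball 0 r \<Longrightarrow> cmod (a d 0) / 2 \<le> cmod (a d t)"
proof -
  have "\<exists>r>0. a i holomorphic_on ball 0 r" if "i \<le> d" for i
    using assms(1)[OF that] by (auto simp: analytic_on_def)
  then obtain s where s: "\<And>i. i \<le> d \<Longrightarrow> 0 < s i \<and> a i holomorphic_on ball 0 (s i)" by metis
  define K where "K = (\<Sum>i\<le>d. cmod (deriv (a i) 0) + 1)"
  have "\<exists>r>0. \<forall>t\<in>ball 0 r. cmod (a i t - a i 0) \<le> K * cmod t" if i: "i \<le> d" for i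
  proof -
    have "(a i has_field_derivative deriv (a i) 0) (at 0)"
      using s[OF i] by (intro holomorphic_derivI[of _ "ball 0 (s i)"]) auto
    then have "(\<lambda>t. (a i t - a i 0) / t) \<midarrow>0\<rightarrow> deriv (a i) 0" by (simp add: DERIV_def)
    then have "(\<lambda>t. cmod ((a i t - a i 0) / t)) \<midarrow>0\<rightarrow> cmod (deriv (a i) 0)" by (rule tendsto_norm)
    then have "\<forall>\<^sub>F t in at 0. cmod ((a i t - a i 0) / t) < cmod (deriv (a i) 0) + 1"
      by (rule order_tendstoD) simp
    then obtain r where r: "r > 0" "\<And>t. t \<noteq> 0 \<Longrightarrow> dist t 0 < r \<Longrightarrow> cmod ((a i t - a i 0) / t) < cmod (deriv (a i) 0) + 1"
      by (auto simp: eventually_at)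
    have "cmod (deriv (a i) 0) + 1 \<le> K"
      unfolding K_def using i by (intro member_le_sum[of i "{..d}" "\<lambda>i. cmod (deriv (a i) 0) + 1"]) auto
    then have "cmod (a i t - a i 0) \<le> K * cmod t" if "t \<in> ball 0 r" for t
    proof (cases "t = 0")
      case False
      then have "cmod ((a i t - a i 0) / t) \<le> K"
        using r(2)[of t] that \<open>_ \<le> K\<close> by auto
      then show ?thesis using False by (simp add: norm_divide field_simps)
    qed simp
    then show ?thesis using r(1) by blast
  qed
  then obtain s' where s': "\<And>i. i \<le> d \<Longrightarrow> 0 < s' i \<and> (\<forall>t\<in>ball 0 (s' i). cmod (a i t - a i 0) \<le> K * cmod t)"
    by metis
  have K: "0 < K" unfolding K_def by (intro sum_pos) (auto intro: add_nonneg_pos)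
  define r where "r = Min (insert 1 (insert (cmod (a d 0) / (2 * K)) (s ` {..d} \<union> s' ` {..d})))"
  have fin: "finite (insert 1 (insert (cmod (a d 0) / (2 * K)) (s ` {..d} \<union> s' ` {..d})))" by simp
  have "0 < r" unfolding r_def using s s' K assms(2) by (subst Min_gr_iff[OF fin]) auto
  moreover have r: "r \<le> 1" "r \<le> cmod (a d 0) / (2 * K)" "\<And>i. i \<le> d \<Longrightarrow> r \<le> s i" "\<And>i. i \<le> d \<Longrightarrow> r \<le> s' i"
    unfolding r_def by (intro Min_le[OF fin]; simp)+
  moreover have "a i holomorphic_on ball 0 r" if "i \<le> d" for i
    using s[OF that] r(3)[OF that] holomorphic_on_subset subset_ball by metis
  moreover have close: "cmod (a i t - a i 0) \<le> K * cmod t" if "i \<le> d" "t \<in> ball 0 r" for i t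
    using s'[OF that(1)] r(4)[OF that(1)] that(2) by auto
  moreover have "cmod (a d 0) / 2 \<le> cmod (a d t)" if "t \<in> ball 0 r" for t
  proof -
    have "cmod (a d t - a d 0) \<le> K * cmod t" using close that by simp
    also have "\<dots> \<le> K * (cmod (a d 0) / (2 * K))" using that r(2) K by (intro mult_left_mono) auto
    also have "\<dots> = cmod (a d 0) / 2" using K by simp
    finally show ?thesis using norm_triangle_ineq2[of "a d 0" "a d t"] by (simp add: norm_minus_commute)
  qed
  ultimately show thesis using that K by blast
qed

section \<open>Attracting skew products near the invariant line\<close>

lemma le_infdistI:
  assumes "S \<noteq> {}" "\<And>y. y \<in> S \<Longrightarrow> m \<le> dist x y"
  shows "m \<le> infdist x S"
  using assms by (simp add: infdist_notempty) (intro cINF_greatest)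

lemma finite_positive_lower_bound:
  fixes S :: "real set"
  assumes "finite S" "\<And>x. x \<in> S \<Longrightarrow> 0 < x"
  shows "\<exists>e>0. \<forall>x\<in>S. e \<le> x"
  using assms by (intro exI[of _ "Min (insert 1 S)"]) auto

text \<open>The attracting skew product over a disk on which its coefficients are controlled. The
degree is written as \<open>n + 2\<close> in order that the derivative of a fibre polynomial has degree \<open>n + 1\<close>.\<close>

locale local_skew_product =
  fixes l :: complex and n d :: nat and a :: "nat \<Rightarrow> complex \<Rightarrow> complex" and r K :: real
  assumes l: "0 < cmod l" "cmod l < 1" and d: "d = Suc (Suc n)" and lead: "a d 0 \<noteq> 0"
    and r: "0 < r" "r \<le> 1" and K: "0 < K"
    and holo_a: "\<And>i. i \<le> d \<Longrightarrow> a i holomorphic_on ball 0 r"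
    and a_near: "\<And>i t. i \<le> d \<Longrightarrow> t \<in> ball 0 r \<Longrightarrow> cmod (a i t - a i 0) \<le> K * cmod t"
    and lead_ge: "\<And>t. t \<in> ball 0 r \<Longrightarrow> cmod (a d 0) / 2 \<le> cmod (a d t)"
begin

abbreviation Q :: "complex \<Rightarrow> complex poly" where "Q t \<equiv> fibre_poly d a t"
abbreviation f :: "complex \<times> complex \<Rightarrow> complex \<times> complex" where "f \<equiv> skew_product l d a"

text \<open>All constants are uniform over the disk: a lower bound for the leading coefficient, an
upper bound for all coefficients, an escape radius, Lipschitz constants \<open>M\<close> of \<open>p\<close> and \<open>B\<close> of the
derivatives of the fibre polynomials, and Lipschitz constants in \<open>t\<close> of the fibre polynomials
and of their derivatives.\<close>

definition lead_bound where "lead_bound = cmod (a d 0) / 2"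
definition coeff_bound where "coeff_bound = (\<Sum>i\<le>d. cmod (a i 0)) + K"
definition R where "R = max 1 ((real d * (real d * coeff_bound) + 2) / lead_bound)"
definition M where "M = max 2 (real d * (real d * coeff_bound) * (R + 2) ^ Suc n)"
definition B where "B = max 1 (real (Suc n) * (real (Suc n) * (real d * coeff_bound)) * (R + 1) ^ n)"
definition A where "A = real (Suc d) * K * (R + 1) ^ d"
definition crit_variation where "crit_variation = real d * (real d * K) * R ^ Suc n"

lemma lead_bound_pos: "0 < lead_bound" using lead by (simp add: lead_bound_def)
lemma coeff_bound_pos: "0 < coeff_bound" unfolding coeff_bound_def using K by (intro add_nonneg_pos sum_nonneg) auto
lemma R_ge_1: "1 \<le> R" by (simp add: R_def)
lemma A_pos: "0 < A" unfolding A_def using K R_ge_1 by (intro mult_pos_pos) auto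
lemma crit_variation_pos: "0 < crit_variation" unfolding crit_variation_def using K R_ge_1 d by (intro mult_pos_pos) auto

lemma norm_coeff_le:
  assumes "t \<in> ball 0 r" "i \<le> d"
  shows "cmod (coeff (Q t) i) \<le> coeff_bound"
proof -
  have "cmod (a i t) \<le> cmod (a i 0) + cmod (a i t - a i 0)"
    using norm_triangle_sub by blast
  also have "cmod (a i t - a i 0) \<le> K * cmod t" using a_near assms by blast
  also have "\<dots> \<le> K * 1" using assms r K by (intro mult_left_mono) auto
  also have "cmod (a i 0) \<le> (\<Sum>i\<le>d. cmod (a i 0))"
    using assms(2) by (intro member_le_sum[of i "{..d}" "\<lambda>i. cmod (a i 0)"]) auto
  finally show ?thesis using assms(2) by (simp add: coeff_fibre_poly coeff_bound_def)
qed

lemma lead_coeff_Q: "t \<in> ball 0 r \<Longrightarrow> lead_bound \<le> cmod (a d t) \<and> a d t \<noteq> 0"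
  using lead_ge[of t] lead_bound_pos by (auto simp: lead_bound_def)

lemma degree_Q: "t \<in> ball 0 r \<Longrightarrow> degree (Q t) = d"
  using lead_coeff_Q[of t] degree_fibre_poly_le[of d a t]
  by (intro antisym le_degree) (auto simp: coeff_fibre_poly)

lemma degree_pderiv_Q: "degree (pderiv (Q t)) \<le> Suc n"
  using degree_fibre_poly_le[of d a t] d by (simp add: degree_pderiv)

lemma pderiv_Q:
  assumes "t \<in> ball 0 r"
  shows "degree (pderiv (Q t)) = Suc n" "lead_bound \<le> cmod (lead_coeff (pderiv (Q t)))" "pderiv (Q t) \<noteq> 0"
proof -
  show deg: "degree (pderiv (Q t)) = Suc n" using degree_Q[OF assms] d by (simp add: degree_pderiv)
  have "1 * lead_bound \<le> real d * cmod (a d t)"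
    using lead_coeff_Q[OF assms] lead_bound_pos d by (intro mult_mono) auto
  also have "real d * cmod (a d t) = cmod (lead_coeff (pderiv (Q t)))"
    unfolding deg coeff_pderiv by (simp add: coeff_fibre_poly d norm_mult del: of_nat_Suc)
  finally show "lead_bound \<le> cmod (lead_coeff (pderiv (Q t)))" by simp
  show "pderiv (Q t) \<noteq> 0" using deg by auto
qed

lemma norm_coeff_pderiv_le:
  "t \<in> ball 0 r \<Longrightarrow> i \<le> Suc n \<Longrightarrow> cmod (coeff (pderiv (Q t)) i) \<le> real d * coeff_bound"
  using coeff_pderiv_norm_le[of "Q t" "Suc n" coeff_bound i] degree_fibre_poly_le[of d a t] norm_coeff_le[of t] d
  by simp

lemma large_norm:
  assumes "R < cmod z"
  shows "1 \<le> cmod z" "real d * (real d * coeff_bound) + 2 \<le> lead_bound * cmod z"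
proof -
  show "1 \<le> cmod z" using assms R_ge_1 by simp
  have "(real d * (real d * coeff_bound) + 2) / lead_bound \<le> cmod z" using assms by (simp add: R_def)
  then show "real d * (real d * coeff_bound) + 2 \<le> lead_bound * cmod z" using lead_bound_pos by (simp add: field_simps)
qed

lemma escape_Q:
  assumes "t \<in> ball 0 r" "R < cmod z"
  shows "2 * cmod z \<le> cmod (poly (Q t) z)"
proof -
  have "1 * (real d * coeff_bound) \<le> real d * (real d * coeff_bound)"
    using coeff_bound_pos d by (intro mult_right_mono) auto
  then have big: "real d * coeff_bound + 2 \<le> lead_bound * cmod z" using large_norm(2)[OF assms(2)] by linarith
  have "2 * cmod z ^ Suc n \<le> cmod (poly (Q t) z)"
  proof (rule norm_poly_ge_near_infinity[where A = coeff_bound and b = lead_bound])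
    show "degree (Q t) \<le> Suc (Suc n)" unfolding d[symmetric] by (rule degree_fibre_poly_le)
    show "cmod (coeff (Q t) i) \<le> coeff_bound" if "i \<le> Suc n" for i
      using that d by (intro norm_coeff_le[OF assms(1)]) linarith
    show "lead_bound \<le> cmod (coeff (Q t) (Suc (Suc n)))"
      unfolding d[symmetric] using lead_coeff_Q[OF assms(1)] by (simp add: coeff_fibre_poly)
    show "real (Suc (Suc n)) * coeff_bound + 2 \<le> lead_bound * cmod z" unfolding d[symmetric] by (rule big)
  qed (rule large_norm(1)[OF assms(2)])
  moreover have "cmod z ^ 1 \<le> cmod z ^ Suc n" using large_norm[OF assms(2)] by (intro power_increasing) auto
  ultimately show ?thesis by simp
qed

lemma critical_point_bounded:
  assumes "t \<in> ball 0 r" "poly (pderiv (Q t)) z = 0"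
  shows "cmod z \<le> R"
proof (rule ccontr)
  assume "\<not> cmod z \<le> R"
  then have z: "R < cmod z" by simp
  have "real (Suc n) * (real d * coeff_bound) \<le> real d * (real d * coeff_bound)"
    using coeff_bound_pos d by (intro mult_right_mono) auto
  then have "2 * cmod z ^ n \<le> cmod (poly (pderiv (Q t)) z)"
    using large_norm[OF z] norm_coeff_pderiv_le[OF assms(1)] pderiv_Q[OF assms(1)]
    by (intro norm_poly_ge_near_infinity[where A = "real d * coeff_bound" and b = lead_bound]) auto
  moreover have "0 < cmod z ^ n" using large_norm[OF z] by (intro zero_less_power) linarith
  ultimately show False using assms(2) by simp
qed

lemma poly_Q_near:
  assumes "t \<in> ball 0 r" "cmod u \<le> R + 1"
  shows "dist (poly (Q 0) u) (poly (Q t) u) \<le> A * cmod t"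
proof -
  have "cmod (poly (Q 0 - Q t) u) \<le> real (Suc d) * (K * cmod t) * (R + 1) ^ d"
    using assms a_near[OF _ assms(1)] R_ge_1
    by (intro norm_poly_le degree_diff_le degree_fibre_poly_le)
      (auto simp: coeff_fibre_poly norm_minus_commute)
  then show ?thesis by (simp add: dist_norm A_def mult_ac)
qed

lemma poly_pderiv_Q_near:
  assumes "t \<in> ball 0 r" "cmod u \<le> R"
  shows "dist (poly (pderiv (Q 0)) u) (poly (pderiv (Q t)) u) \<le> crit_variation * cmod t"
proof -
  have "degree (Q 0 - Q t) \<le> Suc (Suc n)"
    using degree_fibre_poly_le d by (intro degree_diff_le) auto
  moreover have "cmod (coeff (Q 0 - Q t) i) \<le> K * cmod t" if "i \<le> Suc (Suc n)" for i
    using a_near[OF _ assms(1), of i] that d by (auto simp: coeff_fibre_poly norm_minus_commute)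
  ultimately have "cmod (poly (pderiv (Q 0 - Q t)) u) \<le> real (Suc (Suc n)) * (real (Suc (Suc n)) * (K * cmod t)) * R ^ Suc n"
    using assms R_ge_1
    by (intro norm_poly_le coeff_pderiv_norm_le) (auto simp: degree_pderiv)
  then show ?thesis unfolding d[symmetric] by (simp add: dist_norm crit_variation_def pderiv_diff mult_ac)
qed

lemma poly_Q_lipschitz:
  assumes "cmod u \<le> R + 2" "cmod v \<le> R + 2"
  shows "dist (poly (Q 0) u) (poly (Q 0) v) \<le> M * dist u v"
proof -
  have "dist (poly (Q 0) u) (poly (Q 0) v) \<le> real (Suc (Suc n)) * (real (Suc (Suc n)) * coeff_bound) * (R + 2) ^ Suc n * dist u v"
    using assms R_ge_1 degree_fibre_poly_le[of d a 0] norm_coeff_le[of 0] r d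
    by (intro poly_lipschitz_on_cball) auto
  also have "\<dots> \<le> M * dist u v" unfolding d[symmetric] M_def by (intro mult_right_mono max.cobounded2 zero_le_dist)
  finally show ?thesis .
qed

lemma poly_pderiv_Q_lipschitz:
  assumes "t \<in> ball 0 r" "cmod u \<le> R + 1" "cmod v \<le> R + 1"
  shows "dist (poly (pderiv (Q t)) u) (poly (pderiv (Q t)) v) \<le> B * dist u v"
proof -
  have "dist (poly (pderiv (Q t)) u) (poly (pderiv (Q t)) v) \<le>
      real (Suc n) * (real (Suc n) * (real d * coeff_bound)) * (R + 1) ^ n * dist u v"
    using assms R_ge_1 degree_pderiv_Q norm_coeff_pderiv_le by (intro poly_lipschitz_on_cball) auto
  also have "\<dots> \<le> B * dist u v" unfolding B_def by (intro mult_right_mono max.cobounded2 zero_le_dist)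
  finally show ?thesis .
qed

sublocale escaping_entire "poly (Q 0)" R
proof
  show "poly (Q 0) holomorphic_on UNIV"
    unfolding holomorphic_on_def field_differentiable_def by (blast intro: poly_DERIV)
qed (use R_ge_1 escape_Q[of 0] r in auto)

lemma line_julia_eq: "line_julia f = {0} \<times> J"
  by (auto simp: line_julia_def J_def fibre_map_skew_product)

lemma Crit_iff: "(t, z) \<in> Crit f s \<longleftrightarrow> t \<in> ball 0 s \<and> poly (pderiv (Q t)) z = 0"
  by (simp add: Crit_def fibre_map_skew_product deriv_poly)

text \<open>A critical point of the fibre over \<open>t\<close> is bounded, and the derivative of \<open>p\<close> there is of order \<open>t\<close>. This
is impossible far from all the zeros of the derivative of \<open>p\<close>.\<close>

lemma critical_points_near_line:
  assumes "0 < \<eta>"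
  shows "\<exists>s>0. s \<le> r \<and> (\<forall>t z. t \<in> ball 0 s \<and> poly (pderiv (Q t)) z = 0 \<longrightarrow>
    (\<exists>c. poly (pderiv (Q 0)) c = 0 \<and> dist z c < \<eta>))"
proof -
  define s where "s = min r (lead_bound * \<eta> ^ Suc n / crit_variation)"
  have "0 < s" unfolding s_def using r lead_bound_pos assms crit_variation_pos by (auto intro!: divide_pos_pos mult_pos_pos)
  have "\<exists>c. poly (pderiv (Q 0)) c = 0 \<and> dist z c < \<eta>"
    if t: "t \<in> ball 0 s" and z: "poly (pderiv (Q t)) z = 0" for t z
  proof (rule ccontr)
    assume "\<not> ?thesis"
    then have far: "\<And>c. poly (pderiv (Q 0)) c = 0 \<Longrightarrow> \<eta> \<le> dist z c" by force
    have tr: "t \<in> ball 0 r" and t': "cmod t < lead_bound * \<eta> ^ Suc n / crit_variation" using t by (auto simp: s_def)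
    have 0: "0 \<in> ball 0 r" using r by simp
    have "lead_bound * \<eta> ^ Suc n \<le> cmod (lead_coeff (pderiv (Q 0))) * \<eta> ^ degree (pderiv (Q 0))"
      unfolding pderiv_Q(1)[OF 0] using pderiv_Q(2)[OF 0] assms unfolding pderiv_Q(1)[OF 0]
      by (intro mult_right_mono) auto
    also have "\<dots> \<le> cmod (poly (pderiv (Q 0)) z)"
      using norm_poly_ge_dist_roots[OF pderiv_Q(3)[OF 0] _ far] assms by simp
    also have "\<dots> \<le> crit_variation * cmod t"
      using poly_pderiv_Q_near[OF tr critical_point_bounded[OF tr z]] z by (simp add: dist_norm)
    finally show False using t' crit_variation_pos by (simp add: field_simps)
  qed
  then show ?thesis using \<open>0 < s\<close> by (intro exI[of _ s]) (auto simp: s_def)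
qed

text \<open>The disks of radius \<open>\<eta>\<close> about the critical points of \<open>p\<close> are disjoint, so a component of \<open>Crit\<close> lies
over the one whose centre is its point on the line. If that centre is in \<open>J\<close>, the component belongs to
\<open>Crit_julia\<close>.\<close>

lemma Crit_outside_Crit_julia:
  assumes comp: "\<forall>C\<in>components (Crit f s). \<exists>!y. y \<in> C \<and> fst y = 0"
    and near: "\<And>t z. t \<in> ball 0 s \<Longrightarrow> poly (pderiv (Q t)) z = 0 \<Longrightarrow>
       \<exists>c. poly (pderiv (Q 0)) c = 0 \<and> dist z c < \<eta>"
    and sep: "\<And>c c'. poly (pderiv (Q 0)) c = 0 \<Longrightarrow> poly (pderiv (Q 0)) c' = 0 \<Longrightarrow> c \<noteq> c' \<Longrightarrow> 2 * \<eta> \<le> dist c c'"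
    and x: "(t, z) \<in> Crit f s" "(t, z) \<notin> Crit_julia f s"
  shows "\<exists>c. poly (pderiv (Q 0)) c = 0 \<and> c \<notin> J \<and> dist z c < \<eta>"
proof -
  define C where "C = connected_component_set (Crit f s) (t, z)"
  have C: "C \<in> components (Crit f s)" unfolding C_def components_def using x(1) by blast
  have xC: "(t, z) \<in> C" unfolding C_def using x(1) by (simp add: connected_component_refl)
  obtain c where c: "(0, c) \<in> C" using comp C by (metis prod.collapse)
  have CC: "C \<subseteq> Crit f s" using C in_components_subset by blast
  have pc: "poly (pderiv (Q 0)) c = 0" using c CC Crit_iff by blast
  have "c \<notin> J"
  proof
    assume "c \<in> J"
    then have "C \<inter> line_julia f \<noteq> {}" using c by (auto simp: line_julia_eq)
    then show False using x(2) xC C by (auto simp: Crit_julia_def)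
  qed
  define U where "U = (UNIV :: complex set) \<times> ball c \<eta>"
  define V where "V = (\<Union>c'\<in>{c'. poly (pderiv (Q 0)) c' = 0 \<and> c' \<noteq> c}. (UNIV :: complex set) \<times> ball c' \<eta>)"
  have "open U" "open V" unfolding U_def V_def by (auto intro!: open_Times open_UN)
  moreover have "U \<inter> V \<inter> C = {}"
  proof -
    have False if "dist c w < \<eta>" "dist c' w < \<eta>" "poly (pderiv (Q 0)) c' = 0" "c' \<noteq> c" for w c'
      using sep[OF pc that(3)] that dist_triangle2[of c c' w] by auto
    then show ?thesis by (auto simp: U_def V_def)
  qed
  moreover have "C \<subseteq> U \<union> V"
  proof
    fix y assume "y \<in> C"
    obtain y1 y2 where y: "y = (y1, y2)" by fastforce
    then obtain c' where "poly (pderiv (Q 0)) c' = 0" "dist y2 c' < \<eta>"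
      using near[of y1 y2] CC \<open>y \<in> C\<close> Crit_iff by blast
    then show "y \<in> U \<union> V" using y by (cases "c' = c") (auto simp: U_def V_def dist_commute)
  qed
  moreover have "connected C" using C in_components_connected by blast
  ultimately have "U \<inter> C = {} \<or> V \<inter> C = {}" using connectedD by blast
  moreover have "\<eta> > 0"
  proof -
    have "(0, c) \<in> Crit f s" using c CC by blast
    then obtain c' where "dist c c' < \<eta>" using near[of 0 c] pc by (auto simp: Crit_iff)
    then show ?thesis using zero_le_dist[of c c'] by linarith
  qed
  then have "(0, c) \<in> U \<inter> C" using c by (auto simp: U_def)
  ultimately have "(t, z) \<in> U" using xC \<open>C \<subseteq> U \<union> V\<close> by blast
  then show ?thesis using pc \<open>c \<notin> J\<close> by (auto simp: U_def dist_commute)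
qed

lemma funpow_skew_product: "(f ^^ m) (t, z) = (l ^ m * t, snd ((f ^^ m) (t, z)))"
  "snd ((f ^^ Suc m) (t, z)) = poly (Q (l ^ m * t)) (snd ((f ^^ m) (t, z)))"
proof -
  have *: "fst ((f ^^ m) (t, z)) = l ^ m * t" for m
  proof (induction m)
    case (Suc m)
    show ?case using Suc by (cases "(f ^^ m) (t, z)") (auto simp: skew_product_eq)
  qed simp
  then show 1: "(f ^^ m) (t, z) = (l ^ m * t, snd ((f ^^ m) (t, z)))" by (simp add: prod_eq_iff)
  show "snd ((f ^^ Suc m) (t, z)) = poly (Q (l ^ m * t)) (snd ((f ^^ m) (t, z)))"
    by (subst funpow.simps, subst o_apply, subst 1) (simp add: skew_product_eq)
qed

lemma norm_base_le: "cmod (l ^ m * t) \<le> cmod t"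
  unfolding norm_mult norm_power using l by (intro mult_left_le_one_le power_le_one) auto

text \<open>The vertical direction is invariant, so the chain rule gives a product of complex derivatives.\<close>

lemma norm_frechet_derivative_funpow:
  assumes "t \<in> ball 0 r"
  shows "norm (frechet_derivative (f ^^ m) (at (t, z)) (0, 1)) =
    cmod (\<Prod>j<m. poly (pderiv (Q (l ^ j * t))) (snd ((f ^^ j) (t, z))))"
proof -
  define D where "D m = (\<Prod>j<m. poly (pderiv (Q (l ^ j * t))) (snd ((f ^^ j) (t, z))))" for m
  have "\<exists>F. (f ^^ m has_derivative F) (at (t, z)) \<and> F (0, 1) = (0, D m)"
  proof (induction m)
    case 0
    show ?case by (intro exI[of _ "\<lambda>x. x"]) (auto simp: D_def id_def)
  next
    case (Suc m)
    then obtain F where F: "(f ^^ m has_derivative F) (at (t, z))" "F (0, 1) = (0, D m)" by blast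
    define t' z' where "t' = l ^ m * t" and "z' = snd ((f ^^ m) (t, z))"
    have fm: "(f ^^ m) (t, z) = (t', z')" unfolding t'_def z'_def by (rule funpow_skew_product)
    have "t' \<in> ball 0 r" using assms norm_base_le[of m t] by (simp add: t'_def)
    then have "(a i has_field_derivative deriv (a i) t') (at t')" if "i \<le> d" for i
      using holo_a[OF that] by (intro holomorphic_derivI[of _ "ball 0 r"]) auto
    then obtain G where G: "(f has_derivative G) (at (t', z'))"
      "\<And>w. G (0, w) = (0, poly (pderiv (Q t')) z' * w)"
      using skew_product_has_derivative[of d a "\<lambda>i. deriv (a i) t'" t' l z'] by blast
    have "(f \<circ> (f ^^ m) has_derivative G \<circ> F) (at (t, z))"
      using F(1) G(1) fm by (intro diff_chain_at) auto
    moreover have "(G \<circ> F) (0, 1) = (0, D (Suc m))"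
      using F(2) G(2) by (simp add: D_def t'_def z'_def mult.commute)
    ultimately show ?case by (intro exI[of _ "G \<circ> F"] conjI) (simp_all only: funpow.simps)
  qed
  then obtain F where F: "(f ^^ m has_derivative F) (at (t, z))" "F (0, 1) = (0, D m)" by blast
  have "frechet_derivative (f ^^ m) (at (t, z)) = F" using frechet_derivative_at[OF F(1)] by simp
  then show ?thesis using F(2) by (simp add: D_def norm_Pair)
qed

text \<open>An orbit that once leaves the disk of radius \<open>R\<close> has increasing modulus from then on and does not
come near \<open>J\<close>.\<close>

lemma stable_orbit:
  assumes "t \<in> ball 0 r" and lim: "(\<lambda>m. infdist ((f ^^ m) (t, z)) (line_julia f)) \<longlonglongrightarrow> 0"
  shows "(\<lambda>m. infdist (snd ((f ^^ m) (t, z))) J) \<longlonglongrightarrow> 0" "cmod (snd ((f ^^ m) (t, z))) \<le> R"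
proof -
  define u where "u m = snd ((f ^^ m) (t, z))" for m
  have "infdist (u m) J \<le> infdist ((f ^^ m) (t, z)) (line_julia f)" for m
  proof (rule le_infdistI)
    show "line_julia f \<noteq> {}" using J_nonempty by (auto simp: line_julia_eq)
    fix y assume "y \<in> line_julia f"
    then have "snd y \<in> J" by (auto simp: line_julia_eq)
    then have "infdist (u m) J \<le> dist (u m) (snd y)" by (rule infdist_le)
    also have "\<dots> \<le> dist ((f ^^ m) (t, z)) y" unfolding u_def by (rule dist_snd_le)
    finally show "infdist (u m) J \<le> dist ((f ^^ m) (t, z)) y" .
  qed
  then show *: "(\<lambda>m. infdist (snd ((f ^^ m) (t, z))) J) \<longlonglongrightarrow> 0"
    unfolding u_def by (intro tendsto_sandwich[OF _ _ tendsto_const lim] always_eventually allI infdist_nonneg)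
  show "cmod (snd ((f ^^ m) (t, z))) \<le> R"
  proof (rule ccontr)
    assume "\<not> ?thesis"
    then have m: "R < cmod (u m)" by (simp add: u_def)
    have grow: "cmod (u m) \<le> cmod (u (m + j))" for j
    proof (induction j)
      case (Suc j)
      have "l ^ (m + j) * t \<in> ball 0 r" using assms(1) norm_base_le[of "m + j" t] by simp
      then have "2 * cmod (u (m + j)) \<le> cmod (u (m + Suc j))"
        using escape_Q[of "l ^ (m + j) * t" "u (m + j)"] funpow_skew_product(2)[of "m + j" t z] Suc m
        by (simp add: u_def)
      then show ?case using Suc norm_ge_zero[of "u (m + j)"] by linarith
    qed simp
    have "cmod (u m) - R \<le> infdist (u (m + j)) J" for j
    proof (rule le_infdistI[OF J_nonempty])
      fix y assume "y \<in> J"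
      then show "cmod (u m) - R \<le> dist (u (m + j)) y"
        using J_bounded[of y] grow[of j] norm_triangle_ineq2[of "u (m + j)" y] by (simp add: dist_norm)
    qed
    moreover have "(\<lambda>j. infdist (u (m + j)) J) \<longlonglongrightarrow> 0"
      using LIMSEQ_ignore_initial_segment[OF *, of m] by (simp add: u_def add.commute)
    ultimately have "cmod (u m) - R \<le> 0" by (intro LIMSEQ_le_const) auto
    then show False using m by simp
  qed
qed

end

lemma lower_lyapunov_ge:
  assumes "\<And>n. norm (frechet_derivative (f ^^ n) (at x) (0, 1)) = D n" "\<And>n. 0 < D n"
    and "\<And>\<delta>. 0 < \<delta> \<Longrightarrow> \<forall>\<^sub>F n in sequentially. (c - \<delta>) * real n \<le> ln (D n)"
  shows "ereal c \<le> lower_lyapunov f x"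
proof -
  have "ereal (c - \<delta>) \<le> lower_lyapunov f x" if "0 < \<delta>" for \<delta>
    unfolding lower_lyapunov_def
  proof (rule Liminf_bounded)
    have "\<forall>\<^sub>F n in sequentially. 0 < n" by (rule eventually_gt_at_top)
    with assms(3)[OF that]
    show "\<forall>\<^sub>F n in sequentially. ereal (c - \<delta>) \<le>
        ereal (1 / real n) * eln (norm (frechet_derivative (f ^^ n) (at x) (0, 1)))"
    proof eventually_elim
      case (elim n)
      have "\<not> D n \<le> 0" using assms(2)[of n] by simp
      then have "ereal (1 / real n) * eln (D n) = ereal (ln (D n) / real n)"
        by (simp add: eln_def)
      moreover have "c - \<delta> \<le> ln (D n) / real n" using elim by (simp add: field_simps)
      ultimately show ?case using assms(1) by simp
    qed
  qed
  then have "ereal c \<le> lower_lyapunov f x + ereal e" if "0 < e" for e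
    using that by (cases "lower_lyapunov f x") (auto simp: algebra_simps dest: spec[of _ e])
  then show ?thesis by (rule_tac ereal_le_epsilon2) auto
qed

section \<open>The lower vertical Lyapunov exponent\<close>

context local_skew_product
begin

text \<open>A critical point in the fibre of \<open>f^m x\<close> either belongs to \<open>Crit_julia\<close>, where slow approach bounds its
distance, or it stays away from \<open>J\<close>, to which the orbit converges. With \<open>n + 1\<close> critical points in each
fibre, the rate \<open>\<beta> = \<alpha> / (2 d)\<close> for the distances costs at most \<open>\<alpha> / 2\<close> for the derivative,
and the other half absorbs the leading coefficient.\<close>

lemma derivative_not_small:
  assumes t: "t \<in> ball 0 r" and e: "0 < e"
    and lim: "(\<lambda>m. infdist (snd ((f ^^ m) (t, z))) J) \<longlonglongrightarrow> 0"
    and slow: "slowly_approaches f (t, z) (Crit_julia f s)"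
    and ts: "t \<in> ball 0 s"
    and escape: "\<And>t' c. (t', c) \<in> Crit f s \<Longrightarrow> (t', c) \<notin> Crit_julia f s \<Longrightarrow> e \<le> infdist c J"
    and \<alpha>: "0 < \<alpha>"
  shows "\<forall>\<^sub>F m in sequentially. exp (- (\<alpha> * real m)) \<le>
     cmod (poly (pderiv (Q (l ^ m * t))) (snd ((f ^^ m) (t, z))))"
proof -
  define u where "u m = snd ((f ^^ m) (t, z))" for m
  define \<beta> where "\<beta> = \<alpha> / (2 * real d)"
  have \<beta>: "0 < \<beta>" using \<alpha> d by (simp add: \<beta>_def)
  have "\<forall>\<^sub>F m in sequentially. ereal (exp (- \<beta> * real m)) \<le> vdist ((f ^^ m) (t, z)) (Crit_julia f s)"
    using slow \<beta> by (simp add: slowly_approaches_def)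
  moreover have "\<forall>\<^sub>F m in sequentially. infdist (u m) J < e / 2"
    unfolding u_def using lim e by (intro order_tendstoD) auto
  moreover have "\<forall>\<^sub>F m in sequentially. 1 * exp (- (\<beta> * real m)) < e / 2"
    using \<beta> e by (intro eventually_exp_decay_less) auto
  moreover have "\<forall>\<^sub>F m in sequentially. (1 / lead_bound) * exp (- (\<alpha> / 2 * real m)) < 1"
    using \<alpha> by (intro eventually_exp_decay_less) auto
  ultimately show ?thesis
  proof eventually_elim
    case (elim m)
    define t' where "t' = l ^ m * t"
    have t': "t' \<in> ball 0 r" "t' \<in> ball 0 s" using t ts norm_base_le[of m t] by (auto simp: t'_def)
    have eq: "(f ^^ m) (t, z) = (t', u m)" unfolding t'_def u_def by (rule funpow_skew_product(1))
    have far: "exp (- (\<beta> * real m)) \<le> dist (u m) c" if c: "poly (pderiv (Q t')) c = 0" for c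
    proof (cases "(t', c) \<in> Crit_julia f s")
      case True
      have "vdist ((f ^^ m) (t, z)) (Crit_julia f s) \<le> ereal (cmod (u m - c))"
        unfolding vdist_def by (rule INF_lower2[of "(t', c)"])
          (use True eq in auto)
      then have "ereal (exp (- \<beta> * real m)) \<le> ereal (cmod (u m - c))" using elim(1) order_trans by blast
      then show ?thesis by (simp add: dist_norm)
    next
      case False
      then have "e \<le> infdist c J" using escape Crit_iff c t' by blast
      also have "\<dots> \<le> infdist (u m) J + dist c (u m)" by (rule infdist_triangle)
      finally show ?thesis using elim(2,3) by (simp add: dist_commute)
    qed
    have "exp (- (\<alpha> * real m)) \<le> lead_bound * exp (- (\<alpha> / 2 * real m))"
    proof -
      have "exp (- (\<alpha> / 2 * real m)) \<le> lead_bound" using elim(4) lead_bound_pos by (simp add: field_simps)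
      then have "exp (- (\<alpha> / 2 * real m)) * exp (- (\<alpha> / 2 * real m)) \<le> lead_bound * exp (- (\<alpha> / 2 * real m))"
        by (intro mult_right_mono) auto
      then show ?thesis by (simp flip: exp_add)
    qed
    also have "\<dots> \<le> lead_bound * exp (- (\<beta> * real m)) ^ Suc n"
    proof -
      have "exp (- (\<beta> * real m)) ^ Suc n = exp (- (real (Suc n) * (\<beta> * real m)))"
        by (simp only: exp_of_nat_mult[symmetric] mult_minus_right)
      moreover have "real (Suc n) * (\<beta> * real m) \<le> real d * (\<beta> * real m)"
        using \<beta> d by (intro mult_right_mono) auto
      moreover have "real d * (\<beta> * real m) = \<alpha> / 2 * real m" using d by (simp add: \<beta>_def field_simps)
      ultimately show ?thesis using lead_bound_pos by (intro mult_left_mono) auto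
    qed
    also have "\<dots> \<le> cmod (lead_coeff (pderiv (Q t'))) * exp (- (\<beta> * real m)) ^ degree (pderiv (Q t'))"
      using pderiv_Q(2)[OF t'(1)] unfolding pderiv_Q(1)[OF t'(1)] by (intro mult_right_mono) auto
    also have "\<dots> \<le> cmod (poly (pderiv (Q t')) (u m))"
      using far pderiv_Q(3)[OF t'(1)] by (intro norm_poly_ge_dist_roots) auto
    finally show ?case by (simp add: t'_def u_def)
  qed
qed

lemma Fatou_critical_points_isolated:
  obtains d0 \<sigma> where "0 < d0" "0 < \<sigma>"
    "\<And>c. poly (pderiv (Q 0)) c = 0 \<Longrightarrow> c \<notin> J \<Longrightarrow> d0 \<le> infdist c J"
    "\<And>c c'. poly (pderiv (Q 0)) c = 0 \<Longrightarrow> poly (pderiv (Q 0)) c' = 0 \<Longrightarrow> c \<noteq> c' \<Longrightarrow> \<sigma> \<le> dist c c'"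
proof -
  define Z where "Z = {c. poly (pderiv (Q 0)) c = 0}"
  have fin: "finite Z" unfolding Z_def using pderiv_Q(3)[of 0] r by (intro poly_roots_finite) auto
  have "\<exists>e>0. \<forall>x\<in>(\<lambda>c. infdist c J) ` (Z - J). e \<le> x"
    using fin infdist_pos_not_in_closed[OF closed_J J_nonempty]
    by (intro finite_positive_lower_bound) auto
  moreover have "\<exists>e>0. \<forall>x\<in>(\<lambda>(c, c'). dist c c') ` {(c, c') \<in> Z \<times> Z. c \<noteq> c'}. e \<le> x"
    using finite_subset[OF _ finite_cartesian_product[OF fin fin], of "{(c, c') \<in> Z \<times> Z. c \<noteq> c'}"]
    by (intro finite_positive_lower_bound) auto
  ultimately show thesis using that by (force simp: Z_def)
qed

text \<open>Over a small disk the vertical coordinates of an orbit form a pseudo-orbit of \<open>p\<close> with small errors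
from the very beginning, and those do not converge to \<open>J\<close> if they start off \<open>J\<close>.\<close>

lemma stable_set_avoids_Fatou_critical_points:
  assumes shr: "backward_shrinking \<mu> \<rho> C" "1 < \<mu>" "0 < \<rho>" and d0: "0 < d0"
  shows "\<exists>\<epsilon>>0. \<forall>t z c. t \<in> ball 0 r \<longrightarrow> cmod t \<le> \<epsilon> \<longrightarrow> d0 \<le> infdist c J \<longrightarrow> dist c z \<le> \<epsilon> \<longrightarrow>
    \<not> (\<lambda>m. infdist ((f ^^ m) (t, z)) (line_julia f)) \<longlonglongrightarrow> 0"
proof -
  have M2: "2 \<le> M" by (simp add: M_def)
  have "\<exists>\<epsilon>>0. \<forall>c u. d0 \<le> infdist c J \<longrightarrow> dist c (u 0) \<le> \<epsilon> \<longrightarrow>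
     (\<forall>m. dist (poly (Q 0) (u m)) (u (Suc m)) \<le> \<epsilon>) \<longrightarrow> (\<forall>m. cmod (u m) \<le> R) \<longrightarrow>
     \<not> (\<lambda>m. infdist (u m) J) \<longlonglongrightarrow> 0"
    by (rule pseudo_orbit_off_J[OF shr _ M2 d0]) (rule poly_Q_lipschitz; simp)
  then obtain \<epsilon> where \<epsilon>: "\<epsilon> > 0" "\<And>c u. d0 \<le> infdist c J \<Longrightarrow> dist c (u 0) \<le> \<epsilon> \<Longrightarrow>
     (\<And>m. dist (poly (Q 0) (u m)) (u (Suc m)) \<le> \<epsilon>) \<Longrightarrow> (\<And>m. cmod (u m) \<le> R) \<Longrightarrow>
     \<not> (\<lambda>m. infdist (u m) J) \<longlonglongrightarrow> 0" by blast
  define \<epsilon>' where "\<epsilon>' = min \<epsilon> (\<epsilon> / A)"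
  have "\<epsilon>' > 0" using \<epsilon>(1) A_pos by (simp add: \<epsilon>'_def)
  moreover have "\<not> (\<lambda>m. infdist ((f ^^ m) (t, z)) (line_julia f)) \<longlonglongrightarrow> 0"
    if t: "t \<in> ball 0 r" "cmod t \<le> \<epsilon>'" and c: "d0 \<le> infdist c J" "dist c z \<le> \<epsilon>'" for t z c
  proof
    assume lim: "(\<lambda>m. infdist ((f ^^ m) (t, z)) (line_julia f)) \<longlonglongrightarrow> 0"
    define u where "u m = snd ((f ^^ m) (t, z))" for m
    have bd: "cmod (u m) \<le> R" for m unfolding u_def by (rule stable_orbit(2)[OF t(1) lim])
    have "dist (poly (Q 0) (u m)) (u (Suc m)) \<le> \<epsilon>" for m
    proof -
      have "l ^ m * t \<in> ball 0 r" using t(1) norm_base_le[of m t] by simp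
      then have "dist (poly (Q 0) (u m)) (u (Suc m)) \<le> A * cmod (l ^ m * t)"
        using poly_Q_near[of "l ^ m * t" "u m"] bd[of m] funpow_skew_product(2)[of m t z]
        by (simp add: u_def)
      also have "\<dots> \<le> A * (\<epsilon> / A)"
        using norm_base_le[of m t] t(2) A_pos by (intro mult_left_mono) (auto simp: \<epsilon>'_def)
      finally show ?thesis using A_pos by simp
    qed
    then have "\<not> (\<lambda>m. infdist (u m) J) \<longlonglongrightarrow> 0"
      using c bd by (intro \<epsilon>(2)[of c u]) (auto simp: u_def \<epsilon>'_def)
    then show False using stable_orbit(1)[OF t(1) lim] by (simp add: u_def)
  qed
  ultimately show ?thesis by (intro exI[of _ \<epsilon>']) blast
qed

lemma lyapunov_exponent_bound:
  assumes t: "t \<in> ball 0 r" and lim: "(\<lambda>m. infdist ((f ^^ m) (t, z)) (line_julia f)) \<longlonglongrightarrow> 0"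
    and shr: "backward_shrinking \<mu> \<rho> C" "1 < \<mu>" "0 < \<rho>" "0 < C"
    and nz: "\<And>m. poly (pderiv (Q (l ^ m * t))) (snd ((f ^^ m) (t, z))) \<noteq> 0"
    and slow: "\<And>\<alpha>. 0 < \<alpha> \<Longrightarrow> \<forall>\<^sub>F m in sequentially. exp (- (\<alpha> * real m)) \<le>
     cmod (poly (pderiv (Q (l ^ m * t))) (snd ((f ^^ m) (t, z))))"
  shows "ereal (ln \<mu>) \<le> lower_lyapunov f (t, z)"
proof -
  define u where "u m = snd ((f ^^ m) (t, z))" for m
  have tm: "l ^ m * t \<in> ball 0 r" for m using t norm_base_le[of m t] by simp
  have bd: "cmod (u m) \<le> R" for m unfolding u_def by (rule stable_orbit(2)[OF t lim])
  interpret asymptotic_orbit "poly (Q 0)" R "\<lambda>m. poly (Q (l ^ m * t))" u M A "cmod l" B \<mu> \<rho> C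
  proof
    show "poly (Q (l ^ m * t)) holomorphic_on UNIV" for m
      unfolding holomorphic_on_def field_differentiable_def by (blast intro: poly_DERIV)
    show "u (Suc m) = poly (Q (l ^ m * t)) (u m)" for m
      unfolding u_def by (rule funpow_skew_product(2))
    show "(\<lambda>m. infdist (u m) J) \<longlonglongrightarrow> 0" unfolding u_def by (rule stable_orbit(1)[OF t lim])
    show "dist (poly (Q 0) w) (poly (Q (l ^ m * t)) w) \<le> A * cmod l ^ m" if "cmod w \<le> R + 1" for m w
    proof -
      have "cmod l ^ m * cmod t \<le> cmod l ^ m * 1" using t r by (intro mult_left_mono) auto
      then have "A * cmod (l ^ m * t) \<le> A * cmod l ^ m"
        using A_pos by (intro mult_left_mono) (auto simp: norm_mult norm_power)
      then show ?thesis using poly_Q_near[OF tm that] by (rule order_trans[rotated])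
    qed
    show "cmod (deriv (poly (Q (l ^ m * t))) w - deriv (poly (Q (l ^ m * t))) (u m)) \<le> B * dist w (u m)"
      if "w \<in> ball (u m) 1" for m w
    proof -
      have "cmod w \<le> R + 1"
        using that bd[of m] norm_triangle_ineq2[of w "u m"] by (simp add: dist_norm norm_minus_commute)
      then show ?thesis
        using poly_pderiv_Q_lipschitz[OF tm, of w "u m" m] bd[of m] by (simp add: deriv_poly dist_norm)
    qed
    show "\<forall>\<^sub>F m in sequentially. exp (- (\<alpha> * real m)) \<le> cmod (deriv (poly (Q (l ^ m * t))) (u m))"
      if "0 < \<alpha>" for \<alpha>
      unfolding deriv_poly u_def by (rule slow[OF that])
  qed (use bd poly_Q_lipschitz A_pos l shr in \<open>auto simp: M_def B_def\<close>)
  show ?thesis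
  proof (rule lower_lyapunov_ge)
    show "norm (frechet_derivative (f ^^ m) (at (t, z)) (0, 1)) =
        cmod (\<Prod>j<m. deriv (poly (Q (l ^ j * t))) (u j))" for m
      unfolding deriv_poly u_def by (rule norm_frechet_derivative_funpow[OF t])
    show "0 < cmod (\<Prod>j<m. deriv (poly (Q (l ^ j * t))) (u j))" for m
      using nz by (simp add: deriv_poly u_def)
    show "\<forall>\<^sub>F m in sequentially. (ln \<mu> - \<delta>) * real m \<le> ln (cmod (\<Prod>j<m. deriv (poly (Q (l ^ j * t))) (u j)))"
      if "0 < \<delta>" for \<delta>
      using nz that by (intro derivative_growth) (auto simp: deriv_poly u_def)
  qed
qed

text \<open>The size of the disk is fixed before \<open>\<mu>\<close> is given. It is chosen with any one exponent \<open>\<mu>0\<close> for which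
TCE holds, and \<open>\<mu>0\<close> serves only to keep the stable set away from the critical points off \<open>J\<close>. The
exponent \<open>\<mu>\<close> of the conclusion then comes with its own TCE constants.\<close>

lemma eventually_lyapunov_exponent_bound:
  "\<forall>\<^sub>F r\<^sub>0 in at_right 0.
    (\<forall>C\<in>components (Crit f r\<^sub>0). \<exists>!y. y \<in> C \<and> fst y = 0) \<longrightarrow>
    (\<forall>\<mu>>1. TCE P \<mu> \<longrightarrow>
      (\<forall>x\<in>stable_set_julia f r\<^sub>0.
         slowly_approaches f x (Crit_julia f r\<^sub>0) \<and> (\<forall>n. (f ^^ n) x \<notin> Crit_julia f r\<^sub>0) \<longrightarrow>
         lower_lyapunov f x \<ge> ereal (ln \<mu>)))"
proof (cases "\<exists>\<mu>>1. TCE P \<mu>")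
  case True
  then obtain \<mu>0 where \<mu>0: "1 < \<mu>0" "TCE P \<mu>0" by blast
  obtain \<rho>0 C0 where shr0: "backward_shrinking \<mu>0 \<rho>0 C0" "1 < \<mu>0" "0 < \<rho>0"
    using TCE_imp_backward_shrinking[OF \<mu>0(2)] \<mu>0(1) by blast
  obtain d0 \<sigma> where d0: "0 < d0" and \<sigma>: "0 < \<sigma>"
    and iso: "\<And>c. poly (pderiv (Q 0)) c = 0 \<Longrightarrow> c \<notin> J \<Longrightarrow> d0 \<le> infdist c J"
    and sep: "\<And>c c'. poly (pderiv (Q 0)) c = 0 \<Longrightarrow> poly (pderiv (Q 0)) c' = 0 \<Longrightarrow> c \<noteq> c' \<Longrightarrow> \<sigma> \<le> dist c c'"
    using Fatou_critical_points_isolated by blast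
  obtain \<epsilon> where \<epsilon>: "\<epsilon> > 0" and avoid: "\<And>t z c. t \<in> ball 0 r \<Longrightarrow> cmod t \<le> \<epsilon> \<Longrightarrow> d0 \<le> infdist c J \<Longrightarrow>
      dist c z \<le> \<epsilon> \<Longrightarrow> \<not> (\<lambda>m. infdist ((f ^^ m) (t, z)) (line_julia f)) \<longlonglongrightarrow> 0"
    using stable_set_avoids_Fatou_critical_points[OF shr0 d0] by blast
  define \<eta> where "\<eta> = min \<epsilon> (min (d0 / 2) (\<sigma> / 2))"
  have \<eta>: "0 < \<eta>" "\<eta> \<le> \<epsilon>" "\<eta> \<le> d0 / 2" "2 * \<eta> \<le> \<sigma>" using \<epsilon> d0 \<sigma> by (auto simp: \<eta>_def)
  obtain s where s: "0 < s" "s \<le> r" and near: "\<And>t z. t \<in> ball 0 s \<Longrightarrow> poly (pderiv (Q t)) z = 0 \<Longrightarrow>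
      \<exists>c. poly (pderiv (Q 0)) c = 0 \<and> dist z c < \<eta>"
    using critical_points_near_line[OF \<eta>(1)] by blast
  have "ereal (ln \<mu>) \<le> lower_lyapunov f x"
    if r0: "0 < r0" "r0 < min s \<epsilon>"
      and comp: "\<forall>C\<in>components (Crit f r0). \<exists>!y. y \<in> C \<and> fst y = 0"
      and \<mu>: "1 < \<mu>" "TCE P \<mu>" and x: "x \<in> stable_set_julia f r0"
      and slow: "slowly_approaches f x (Crit_julia f r0)" and out: "\<And>n. (f ^^ n) x \<notin> Crit_julia f r0"
    for r0 \<mu> x
  proof -
    obtain t z where xt: "x = (t, z)" by fastforce
    have t: "t \<in> ball 0 r0" and lim: "(\<lambda>m. infdist ((f ^^ m) (t, z)) (line_julia f)) \<longlonglongrightarrow> 0"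
      using x by (auto simp: stable_set_julia_def xt)
    have tr: "t \<in> ball 0 r" using t r0 s by auto
    have Fatou_near: "\<exists>c. poly (pderiv (Q 0)) c = 0 \<and> c \<notin> J \<and> dist w c < \<eta>"
      if "(t', w) \<in> Crit f r0" "(t', w) \<notin> Crit_julia f r0" for t' w
    proof (rule Crit_outside_Crit_julia[OF comp _ _ that])
      show "\<exists>c. poly (pderiv (Q 0)) c = 0 \<and> dist z c < \<eta>"
        if "t \<in> ball 0 r0" "poly (pderiv (Q t)) z = 0" for t z
        using near[of t z] that r0 by auto
      show "2 * \<eta> \<le> dist c c'"
        if "poly (pderiv (Q 0)) c = 0" "poly (pderiv (Q 0)) c' = 0" "c \<noteq> c'" for c c'
        using sep[OF that] \<eta> by linarith
    qed
    obtain \<rho> C where shr: "backward_shrinking \<mu> \<rho> C" "0 < \<rho>" "0 < C"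
      using TCE_imp_backward_shrinking[OF \<mu>(2)] by blast
    have "ereal (ln \<mu>) \<le> lower_lyapunov f (t, z)"
    proof (rule lyapunov_exponent_bound[OF tr lim shr(1) \<mu>(1) shr(2,3)])
      fix m
      define t' w where "t' = l ^ m * t" and "w = snd ((f ^^ m) (t, z))"
      have eq: "(f ^^ m) (t, z) = (t', w)" unfolding t'_def w_def by (rule funpow_skew_product)
      have t': "t' \<in> ball 0 r0" "t' \<in> ball 0 r" "cmod t' \<le> \<epsilon>"
        using t tr r0 norm_base_le[of m t] by (auto simp: t'_def)
      show "poly (pderiv (Q (l ^ m * t))) (snd ((f ^^ m) (t, z))) \<noteq> 0"
      proof
        assume "poly (pderiv (Q (l ^ m * t))) (snd ((f ^^ m) (t, z))) = 0"
        then have "(t', w) \<in> Crit f r0" using t' by (simp add: Crit_iff t'_def w_def)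
        moreover have "(t', w) \<notin> Crit_julia f r0" using out[of m] by (simp add: xt eq)
        ultimately obtain c where c: "poly (pderiv (Q 0)) c = 0" "c \<notin> J" "dist w c < \<eta>"
          using Fatou_near by blast
        have "\<not> (\<lambda>k. infdist ((f ^^ k) (t', w)) (line_julia f)) \<longlonglongrightarrow> 0"
          using c \<eta> by (intro avoid[OF t'(2,3) iso[OF c(1,2)]]) (simp add: dist_commute)
        moreover have "(\<lambda>k. infdist ((f ^^ k) (t', w)) (line_julia f)) \<longlonglongrightarrow> 0"
          using LIMSEQ_ignore_initial_segment[OF lim, of m] by (simp add: funpow_add eq)
        ultimately show False by simp
      qed
    next
      fix \<alpha> :: real assume \<alpha>: "0 < \<alpha>"
      show "\<forall>\<^sub>F m in sequentially. exp (- (\<alpha> * real m)) \<le>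
          cmod (poly (pderiv (Q (l ^ m * t))) (snd ((f ^^ m) (t, z))))"
      proof (rule derivative_not_small[OF tr _ stable_orbit(1)[OF tr lim] slow[unfolded xt] t _ \<alpha>])
        show "0 < d0 / 2" using d0 by simp
        fix t' c assume "(t', c) \<in> Crit f r0" "(t', c) \<notin> Crit_julia f r0"
        then obtain c' where c': "poly (pderiv (Q 0)) c' = 0" "c' \<notin> J" "dist c c' < \<eta>"
          using Fatou_near by blast
        then show "d0 / 2 \<le> infdist c J"
          using iso[OF c'(1,2)] infdist_triangle[of c' J c] \<eta> by (simp add: dist_commute)
      qed
    qed
    then show ?thesis by (simp add: xt)
  qed
  moreover have "\<forall>\<^sub>F r\<^sub>0 in at_right 0. 0 < r\<^sub>0 \<and> r\<^sub>0 < min s \<epsilon>"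
    unfolding eventually_at_right_field using s(1) \<epsilon> by (intro exI[of _ "min s \<epsilon>"]) auto
  ultimately show ?thesis by (auto elim!: eventually_mono)
next
  case False
  then show ?thesis by (auto intro!: always_eventually)
qed

end

theorem theorem1p4:
  fixes l :: complex and d :: nat and a :: "nat \<Rightarrow> complex \<Rightarrow> complex"
    and f :: "complex \<times> complex \<Rightarrow> complex \<times> complex" and P :: "riemann_sphere \<Rightarrow> riemann_sphere"
  assumes "0 < cmod l" "cmod l < 1" and "d \<ge> 2"
    and "\<And>i. i \<le> d \<Longrightarrow> a i analytic_on {0}" and "a d 0 \<noteq> 0"
    and "f = skew_product l d a" and "P = sphere_ext (fibre_map f 0)"
  shows "\<forall>\<^sub>F r\<^sub>0 in at_right 0.
    (\<forall>C\<in>components (Crit f r\<^sub>0). \<exists>!y. y \<in> C \<and> fst y = 0) \<longrightarrow>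
    (\<forall>\<mu>>1. TCE P \<mu> \<longrightarrow>
      (\<forall>x\<in>stable_set_julia f r\<^sub>0.
         slowly_approaches f x (Crit_julia f r\<^sub>0) \<and>
         (\<forall>n. (f ^^ n) x \<notin> Crit_julia f r\<^sub>0) \<longrightarrow>
         lower_lyapunov f x \<ge> ereal (ln \<mu>)))"
proof -
  obtain r K where r: "0 < r" "r \<le> 1" "0 < K"
    "\<And>i. i \<le> d \<Longrightarrow> a i holomorphic_on ball 0 r"
    "\<And>i t. i \<le> d \<Longrightarrow> t \<in> ball 0 r \<Longrightarrow> cmod (a i t - a i 0) \<le> K * cmod t"
    "\<And>t. t \<in> ball 0 r \<Longrightarrow> cmod (a d 0) / 2 \<le> cmod (a d t)"
    using coefficients_near_zero[of d a] assms(4,5) by blast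
  interpret local_skew_product l "d - 2" d a r K
    using assms r by unfold_locales auto
  show ?thesis
    using eventually_lyapunov_exponent_bound
    unfolding assms(6,7) fibre_map_skew_product .
qed

end
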